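(* Let $\mathcal A\subseteq\mathcal Q=\{1,\dots,q\}$ be an arbitrary active set that exists for the QP described in the context (i.e. there is $x\in\mathcal X_f$ with $\mathcal A(x)=\mathcal A$), where the constraints are ordered as in the context. Let $q_{\mathrm{stage}}=q_{\mathcal U}+q_{\mathcal X}$, $\tilde{\mathcal A}=\mathcal A\cap\{1,\dots,q_{\mathrm{stage}}\}$, and let $G^{11}$ be the block consisting of the first $q_{\mathrm{stage}}$ rows and first $m$ columns of $G$. If $G^{11}_{\tilde{\mathcal A}}$ is invertible, then the feedback law $K^\star x+b^\star$ with $$K^\star=(G^{11}_{\tilde{\mathcal A}})^{-1}E_{\tilde{\mathcal A}},\qquad b^\star=(G^{11}_{\tilde{\mathcal A}})^{-1}w_{\tilde{\mathcal A}}$$ yields the same optimal input $u^\star(0)$ as the QP for all $x\in\Gamma(\mathcal A)$; that is, for every $x\in\Gamma(\mathcal A)$ the first $m$ components of the optimal solution $\bar U^\star(x)$ of the QP equal $K^\star x+b^\star$, where $$\Gamma(\mathcal A)=\bigcup_{\mathcal A'\in\mathcal M(\mathcal A)}\Pi(\mathcal A'),\qquad \mathcal M(\mathcal A)=\{\mathcal A'\subseteq\mathcal Q\mid\mathcal A'\cap\{1,\dots,q_{\mathrm{stage}}\}=\mathcal A\cap\{1,\dots,q_{\mathrm{stage}}\}\}.$$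
   Context: Optimal control problem. Let $N\ge 2$ be the horizon, $A\in\mathbb R^{n\times n}$, $B\in\mathbb R^{n\times m}$. For a given initial state $x(0)\in\mathbb R^n$ (also written $x$) minimize $\|x(N)\|_P^2+\sum_{k=0}^{N-1}(\|x(k)\|_Q^2+\|u(k)\|_R^2)$ (with $\|v\|_M^2=v'Mv$, and $'$ on vectors and matrices denoting transpose) over $u(0),\dots,u(N-1)\in\mathbb R^m$ and $x(1),\dots,x(N)\in\mathbb R^n$, subject to $x(k+1)=Ax(k)+Bu(k)$, $x(k)\in\mathcal X$, $u(k)\in\mathcal U$ for $k=0,\dots,N-1$, and $x(N)\in\mathcal T$. Standing assumptions: $(A,B)$ stabilizable, $(Q^{1/2},A)$ detectable, $Q\succeq0$, $R\succ0$; $\mathcal X\subset\mathbb R^n$, $\mathcal U\subset\mathbb R^m$ and $\mathcal T\subseteq\mathcal X$ are compact polytopes (a polytope is an intersection of finitely many halfspaces) containing the origin as an interior point. $P\succ0$ is the solution of the discrete-time algebraic Riccati equation, and $\mathcal T$ is the closure of the largest open set on which the associated linear quadratic regulator stabilizes the system without activating the constraints. $\mathcal U,\mathcal X,\mathcal T$ are given by $q_{\mathcal U},q_{\mathcal X},q_{\mathcal T}$ halfspaces (linear inequalities), respectively. QP. Eliminating $x(1),\dots,x(N)$ by $x(k)=A^kx(0)+\sum_{j=0}^{k-1}A^{k-1-j}Bu(j)$ in the cost and in the inequalities turns the problem into the equivalent QP $\min_{\bar U}\frac12\bar U'H\bar U+x'F\bar U+\frac12x'Yx$ subject to $G\bar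 U\le w+Ex$, with $\bar U=(u(0)',\dots,u(N-1)')'\in\mathbb R^{mN}$, $H\succ0$, $G\in\mathbb R^{q\times mN}$, $w\in\mathbb R^q$, $E\in\mathbb R^{q\times n}$, where $q$ is the total number of inequalities. Order of constraints: the rows of $G,w,E$ correspond to the inequalities in the order $u(0)\in\mathcal U$, $x(1)\in\mathcal X$; $u(1)\in\mathcal U$, $x(2)\in\mathcal X$; $\dots$; $u(N-1)\in\mathcal U$, $x(N)\in\mathcal T$; and finally $x(0)\in\mathcal X$. Consequently the first $q_{\mathcal U}+q_{\mathcal X}$ rows of $G$ have the form $(G^{11}\ \ 0)$ with $G^{11}$ having $m$ columns. Active sets. $\mathcal X_f$ is the set of $x$ for which the QP has a solution; for $x\in\mathcal X_f$ the solution $\bar U^\star(x)$ is unique. $\mathcal A(x)=\{i\in\mathcal Q\mid G_i\bar U^\star(x)=w_i+E_ix\}$, $\mathcal Q=\{1,\dots,q\}$. A matrix or vector with a set index denotes the submatrix/subvector of the rows with these indices. Polytopes. For $\mathcal A\subseteq\mathcal Q$ with $G_{\mathcal A}$ of full row rank, put $\mathcal I=\mathcal Q\setminus\mathcal A$, $S=E+GH^{-1}F'$, $W=(G_{\mathcal A}H^{-1}(G_{\mathcal A})')^{-1}$ and $\Pi(\mathcal A)=\{x\in\mathbb R^n\mid Tx\le d\}$ with $$T=\begin{pmatrix}WS_{\mathcal A} \\ G_{\mathcal I}H^{-1}(G_{\mathcal A})'WS_{\mathcal A}-S_{\mathcal I}\end{pmatrix},\quad d=-\begin{pmatrix}Ww_{\mathcal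 A} \\ G_{\mathcal I}H^{-1}(G_{\mathcal A})'Ww_{\mathcal A}-w_{\mathcal I}\end{pmatrix}$$ (for $\mathcal A=\emptyset$ the terms involving $\mathcal A$ are absent). $\Pi(\mathcal A')$ is defined only when $G_{\mathcal A'}$ has full row rank, so only such $\mathcal A'$ contribute to the union defining $\Gamma(\mathcal A)$. *)

theory Defs
  imports
    "HOL-Analysis.Function_Topology"
    "Jordan_Normal_Form.Char_Poly"
    "Jordan_Normal_Form.Gauss_Jordan_Elimination"
    "Jordan_Normal_Form.DL_Rank"
    "Jordan_Normal_Form.DL_Submatrix"
begin

text \<open>
  Vectors and matrices are those of Jordan\_Normal\_Form, because the dimension of the stacked
  input and the number of constraints depend on the horizon.  Rows, constraints and components are
  numbered from 0; the index set \<open>{1,\<dots>,q}\<close> becomes \<open>{..<q}\<close>.  The order on vectors is the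
  componentwise one.
\<close>

section \<open>Linear algebra\<close>

text \<open>Only meaningful for invertible \<open>M\<close>.\<close>

definition minv :: "real mat \<Rightarrow> real mat" where
  "minv M = the (mat_inverse M)"

definition psd :: "nat \<Rightarrow> real mat \<Rightarrow> bool" where
  "psd n M \<longleftrightarrow> M \<in> carrier_mat n n \<and> M\<^sup>T = M \<and> (\<forall>v\<in>carrier_vec n. v \<bullet> (M *\<^sub>v v) \<ge> 0)"

definition pd :: "nat \<Rightarrow> real mat \<Rightarrow> bool" where
  "pd n M \<longleftrightarrow> M \<in> carrier_mat n n \<and> M\<^sup>T = M \<and>
     (\<forall>v\<in>carrier_vec n. v \<noteq> 0\<^sub>v n \<longrightarrow> v \<bullet> (M *\<^sub>v v) > 0)"

definition psd_sqrt :: "nat \<Rightarrow> real mat \<Rightarrow> real mat" where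
  "psd_sqrt n M = (THE S. psd n S \<and> S * S = M)"

text \<open>Submatrix and subvector of the rows with indices in \<open>I\<close>, in increasing order.\<close>

definition rows_of :: "real mat \<Rightarrow> nat set \<Rightarrow> real mat" where
  "rows_of M I = submatrix M I UNIV"

definition entries_of :: "real vec \<Rightarrow> nat set \<Rightarrow> real vec" where
  "entries_of v I = vec (card {i. i < dim_vec v \<and> i \<in> I}) (\<lambda>i. v $ pick I i)"

definition full_row_rank :: "real mat \<Rightarrow> bool" where
  "full_row_rank M \<longleftrightarrow> vec_space.rank (dim_row M) M = dim_row M"

text \<open>The sum \<open>f 0 + \<dots> + f (N - 1)\<close> of \<open>r \<times> c\<close> matrices; matrices of varying
  dimension do not form a monoid with zero, so the sum operator of the library does not apply.\<close>

definition msum :: "nat \<Rightarrow> nat \<Rightarrow> (nat \<Rightarrow> real mat) \<Rightarrow> nat \<Rightarrow> real mat" where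
  "msum r c f N = mat r c (\<lambda>ij. \<Sum>k<N. f k $$ ij)"

section \<open>Control-theoretic notions\<close>

definition schur_stable :: "real mat \<Rightarrow> bool" where
  "schur_stable M \<longleftrightarrow> (\<forall>ev. eigenvalue (map_mat complex_of_real M) ev \<longrightarrow> cmod ev < 1)"

definition stabilizable :: "real mat \<Rightarrow> real mat \<Rightarrow> bool" where
  "stabilizable A B \<longleftrightarrow> (\<exists>K\<in>carrier_mat (dim_col B) (dim_row A). schur_stable (A + B * K))"

definition detectable :: "real mat \<Rightarrow> real mat \<Rightarrow> bool" where
  "detectable C A \<longleftrightarrow> (\<exists>L\<in>carrier_mat (dim_row A) (dim_row C). schur_stable (A + L * C))"

text \<open>The usual topology of \<open>\<real>\<^sup>n\<close>, transported to \<open>carrier_vec n\<close>.\<close>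

definition vec_topology :: "nat \<Rightarrow> real vec topology" where
  "vec_topology n = pullback_topology (carrier_vec n) (\<lambda>v. \<lambda>i\<in>{..<n}. v $ i)
     (product_topology (\<lambda>_. euclideanreal) {..<n})"

definition polyhedron :: "nat \<Rightarrow> real mat \<Rightarrow> real vec \<Rightarrow> real vec set" where
  "polyhedron n M h = {v \<in> carrier_vec n. M *\<^sub>v v \<le> h}"

text \<open>\<open>M v \<le> h\<close> is a list of halfspaces (nonzero normals) whose intersection is compact and
  contains the origin in its interior.\<close>

definition polytope_around_0 :: "nat \<Rightarrow> real mat \<Rightarrow> real vec \<Rightarrow> bool" where
  "polytope_around_0 n M h \<longleftrightarrow>
     M \<in> carrier_mat (dim_vec h) n \<and> (\<forall>i<dim_vec h. row M i \<noteq> 0\<^sub>v n) \<and>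
     compactin (vec_topology n) (polyhedron n M h) \<and>
     0\<^sub>v n \<in> (vec_topology n) interior_of (polyhedron n M h)"

section \<open>The optimal control problem\<close>

text \<open>\<open>(HX, hX)\<close>, \<open>(HU, hU)\<close>, \<open>(HT, hT)\<close> are the halfspace representations of the state, input
  and terminal constraint sets.\<close>

record ocp =
  nx :: nat
  nu :: nat
  hor :: nat
  Amat :: "real mat"
  Bmat :: "real mat"
  Qmat :: "real mat"
  Rmat :: "real mat"
  Pmat :: "real mat"
  HX :: "real mat"
  hX :: "real vec"
  HU :: "real mat"
  hU :: "real vec"
  HT :: "real mat"
  hT :: "real vec"

definition Xset :: "ocp \<Rightarrow> real vec set" where "Xset D = polyhedron (nx D) (HX D) (hX D)"
definition Uset :: "ocp \<Rightarrow> real vec set" where "Uset D = polyhedron (nu D) (HU D) (hU D)"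
definition Tset :: "ocp \<Rightarrow> real vec set" where "Tset D = polyhedron (nx D) (HT D) (hT D)"

definition dare :: "ocp \<Rightarrow> bool" where
  "dare D \<longleftrightarrow> (let A = Amat D; B = Bmat D; P = Pmat D in
     P = A\<^sup>T * P * A - A\<^sup>T * P * B * minv (Rmat D + B\<^sup>T * P * B) * (B\<^sup>T * P * A) + Qmat D)"

definition lqr_gain :: "ocp \<Rightarrow> real mat" where
  "lqr_gain D = (let A = Amat D; B = Bmat D; P = Pmat D in
     - (minv (Rmat D + B\<^sup>T * P * B) * (B\<^sup>T * P * A)))"

definition lqr_state :: "ocp \<Rightarrow> real vec \<Rightarrow> nat \<Rightarrow> real vec" where
  "lqr_state D x k = ((Amat D + Bmat D * lqr_gain D) ^\<^sub>m k) *\<^sub>v x"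

definition inactive :: "real mat \<Rightarrow> real vec \<Rightarrow> real vec \<Rightarrow> bool" where
  "inactive M h v \<longleftrightarrow> (\<forall>i<dim_vec h. (M *\<^sub>v v) $ i < h $ i)"

text \<open>Open sets on which the linear quadratic regulator stabilizes the system without activating
  the constraints.\<close>

definition lqr_region :: "ocp \<Rightarrow> real vec set \<Rightarrow> bool" where
  "lqr_region D V \<longleftrightarrow> openin (vec_topology (nx D)) V \<and>
     (\<forall>x\<in>V. limitin (vec_topology (nx D)) (lqr_state D x) (0\<^sub>v (nx D)) sequentially \<and>
       (\<forall>k. inactive (HX D) (hX D) (lqr_state D x k) \<and>
            inactive (HU D) (hU D) (lqr_gain D *\<^sub>v lqr_state D x k)))"

definition standing_assumptions :: "ocp \<Rightarrow> bool" where
  "standing_assumptions D \<longleftrightarrow>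
     hor D \<ge> 2 \<and>
     Amat D \<in> carrier_mat (nx D) (nx D) \<and> Bmat D \<in> carrier_mat (nx D) (nu D) \<and>
     psd (nx D) (Qmat D) \<and> pd (nu D) (Rmat D) \<and>
     stabilizable (Amat D) (Bmat D) \<and> detectable (psd_sqrt (nx D) (Qmat D)) (Amat D) \<and>
     polytope_around_0 (nx D) (HX D) (hX D) \<and>
     polytope_around_0 (nu D) (HU D) (hU D) \<and>
     polytope_around_0 (nx D) (HT D) (hT D) \<and> Tset D \<subseteq> Xset D \<and>
     pd (nx D) (Pmat D) \<and> dare D \<and>
     (\<exists>V. lqr_region D V \<and> (\<forall>V'. lqr_region D V' \<longrightarrow> V' \<subseteq> V) \<and>
          Tset D = Abstract_Topology.closure_of (vec_topology (nx D)) V)"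

text \<open>The problem before elimination of the states, with the inputs \<open>u 0, \<dots>, u (N - 1)\<close> stacked
  into one vector \<open>U\<close>.\<close>

definition input :: "ocp \<Rightarrow> real vec \<Rightarrow> nat \<Rightarrow> real vec" where
  "input D U k = vec (nu D) (\<lambda>i. U $ (k * nu D + i))"

primrec state :: "ocp \<Rightarrow> real vec \<Rightarrow> real vec \<Rightarrow> nat \<Rightarrow> real vec" where
  "state D x U 0 = x"
| "state D x U (Suc k) = Amat D *\<^sub>v state D x U k + Bmat D *\<^sub>v input D U k"

definition ocp_cost :: "ocp \<Rightarrow> real vec \<Rightarrow> real vec \<Rightarrow> real" where
  "ocp_cost D x U =
     state D x U (hor D) \<bullet> (Pmat D *\<^sub>v state D x U (hor D)) +
     (\<Sum>k<hor D. state D x U k \<bullet> (Qmat D *\<^sub>v state D x U k) +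
                 input D U k \<bullet> (Rmat D *\<^sub>v input D U k))"

definition ocp_feasible :: "ocp \<Rightarrow> real vec \<Rightarrow> real vec \<Rightarrow> bool" where
  "ocp_feasible D x U \<longleftrightarrow>
     (\<forall>k<hor D. state D x U k \<in> Xset D \<and> input D U k \<in> Uset D) \<and> state D x U (hor D) \<in> Tset D"

section \<open>The condensed quadratic program\<close>

definition nU :: "ocp \<Rightarrow> nat" where "nU D = nu D * hor D"

text \<open>\<open>u k = sel D k *\<^sub>v U\<close> and \<open>x k = Phi D k *\<^sub>v x + Gam D k *\<^sub>v U\<close>; see the lemmas
  \<open>input_eq\<close> and \<open>state_eq\<close> below.\<close>

definition sel :: "ocp \<Rightarrow> nat \<Rightarrow> real mat" where
  "sel D k = mat (nu D) (nU D) (\<lambda>(i, c). if c = k * nu D + i then 1 else 0)"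

definition Phi :: "ocp \<Rightarrow> nat \<Rightarrow> real mat" where
  "Phi D k = Amat D ^\<^sub>m k"

definition Gam :: "ocp \<Rightarrow> nat \<Rightarrow> real mat" where
  "Gam D k = msum (nx D) (nU D) (\<lambda>j. Amat D ^\<^sub>m (k - 1 - j) * Bmat D * sel D j) k"

definition Hmat :: "ocp \<Rightarrow> real mat" where
  "Hmat D = 2 \<cdot>\<^sub>m ((Gam D (hor D))\<^sup>T * Pmat D * Gam D (hor D) +
     msum (nU D) (nU D) (\<lambda>k. (Gam D k)\<^sup>T * Qmat D * Gam D k + (sel D k)\<^sup>T * Rmat D * sel D k) (hor D))"

definition Fmat :: "ocp \<Rightarrow> real mat" where
  "Fmat D = 2 \<cdot>\<^sub>m ((Phi D (hor D))\<^sup>T * Pmat D * Gam D (hor D) +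
     msum (nx D) (nU D) (\<lambda>k. (Phi D k)\<^sup>T * Qmat D * Gam D k) (hor D))"

definition Ymat :: "ocp \<Rightarrow> real mat" where
  "Ymat D = 2 \<cdot>\<^sub>m ((Phi D (hor D))\<^sup>T * Pmat D * Phi D (hor D) +
     msum (nx D) (nx D) (\<lambda>k. (Phi D k)\<^sup>T * Qmat D * Phi D k) (hor D))"

text \<open>The constraint on the state \<open>x k\<close>, for \<open>1 \<le> k \<le> N\<close>.\<close>

definition HS :: "ocp \<Rightarrow> nat \<Rightarrow> real mat" where
  "HS D k = (if k = hor D then HT D else HX D)"

definition hS :: "ocp \<Rightarrow> nat \<Rightarrow> real vec" where
  "hS D k = (if k = hor D then hT D else hX D)"

text \<open>Order of the inequalities: for \<open>k = 0, \<dots>, N - 1\<close> those on \<open>u k\<close> followed by those on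
  \<open>x (k + 1)\<close>, and those on \<open>x 0\<close> at the very end.\<close>

definition Gmat :: "ocp \<Rightarrow> real mat" where
  "Gmat D = mat_of_rows (nU D)
     (concat (map (\<lambda>k. rows (HU D * sel D k) @ rows (HS D (Suc k) * Gam D (Suc k))) [0..<hor D]) @
      rows (0\<^sub>m (dim_row (HX D)) (nU D)))"

definition wvec :: "ocp \<Rightarrow> real vec" where
  "wvec D = vec_of_list
     (concat (map (\<lambda>k. list_of_vec (hU D) @ list_of_vec (hS D (Suc k))) [0..<hor D]) @
      list_of_vec (hX D))"

definition Emat :: "ocp \<Rightarrow> real mat" where
  "Emat D = mat_of_rows (nx D)
     (concat (map (\<lambda>k. rows (0\<^sub>m (dim_row (HU D)) (nx D)) @ rows (- (HS D (Suc k) * Phi D (Suc k))))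
        [0..<hor D]) @
      rows (- HX D))"

definition Qset :: "ocp \<Rightarrow> nat set" where
  "Qset D = {..<dim_row (Gmat D)}"

definition qp_cost :: "ocp \<Rightarrow> real vec \<Rightarrow> real vec \<Rightarrow> real" where
  "qp_cost D x U = 1/2 * (U \<bullet> (Hmat D *\<^sub>v U)) + x \<bullet> (Fmat D *\<^sub>v U) + 1/2 * (x \<bullet> (Ymat D *\<^sub>v x))"

definition qp_feasible :: "ocp \<Rightarrow> real vec \<Rightarrow> real vec \<Rightarrow> bool" where
  "qp_feasible D x U \<longleftrightarrow> U \<in> carrier_vec (nU D) \<and> Gmat D *\<^sub>v U \<le> wvec D + Emat D *\<^sub>v x"

definition qp_solution :: "ocp \<Rightarrow> real vec \<Rightarrow> real vec \<Rightarrow> bool" where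
  "qp_solution D x U \<longleftrightarrow>
     qp_feasible D x U \<and> (\<forall>V. qp_feasible D x V \<longrightarrow> qp_cost D x U \<le> qp_cost D x V)"

definition Xf :: "ocp \<Rightarrow> real vec set" where
  "Xf D = {x \<in> carrier_vec (nx D). \<exists>U. qp_solution D x U}"

text \<open>Meaningful for \<open>x \<in> Xf D\<close>, where the solution is unique.\<close>

definition Uopt :: "ocp \<Rightarrow> real vec \<Rightarrow> real vec" where
  "Uopt D x = (THE U. qp_solution D x U)"

definition active_set :: "ocp \<Rightarrow> real vec \<Rightarrow> nat set" where
  "active_set D x = {i \<in> Qset D. (Gmat D *\<^sub>v Uopt D x) $ i = (wvec D + Emat D *\<^sub>v x) $ i}"

section \<open>The regions and the feedback law\<close>

text \<open>For \<open>\<A> = {}\<close>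
  the matrix \<open>rows_of (Gmat D) \<A>\<close> has no rows, so that the first blocks vanish and the products
  with \<open>Wmat\<close> are zero matrices of the right dimension.\<close>

definition Smat :: "ocp \<Rightarrow> real mat" where
  "Smat D = Emat D + Gmat D * minv (Hmat D) * (Fmat D)\<^sup>T"

definition Wmat :: "ocp \<Rightarrow> nat set \<Rightarrow> real mat" where
  "Wmat D \<A> = minv (rows_of (Gmat D) \<A> * minv (Hmat D) * (rows_of (Gmat D) \<A>)\<^sup>T)"

definition PiT :: "ocp \<Rightarrow> nat set \<Rightarrow> real mat" where
  "PiT D \<A> = (let \<I> = Qset D - \<A>; G\<^sub>A = rows_of (Gmat D) \<A>; G\<^sub>I = rows_of (Gmat D) \<I>;
       W = Wmat D \<A> in
     (W * rows_of (Smat D) \<A>) @\<^sub>r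
     (G\<^sub>I * minv (Hmat D) * G\<^sub>A\<^sup>T * W * rows_of (Smat D) \<A> - rows_of (Smat D) \<I>))"

definition Pid :: "ocp \<Rightarrow> nat set \<Rightarrow> real vec" where
  "Pid D \<A> = (let \<I> = Qset D - \<A>; G\<^sub>A = rows_of (Gmat D) \<A>; G\<^sub>I = rows_of (Gmat D) \<I>;
       W = Wmat D \<A> in
     - ((W *\<^sub>v entries_of (wvec D) \<A>) @\<^sub>v
        ((G\<^sub>I * minv (Hmat D) * G\<^sub>A\<^sup>T * W) *\<^sub>v entries_of (wvec D) \<A> - entries_of (wvec D) \<I>)))"

definition Pi_region :: "ocp \<Rightarrow> nat set \<Rightarrow> real vec set" where
  "Pi_region D \<A> = {x \<in> carrier_vec (nx D). PiT D \<A> *\<^sub>v x \<le> Pid D \<A>}"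

definition qstage :: "ocp \<Rightarrow> nat" where
  "qstage D = dim_row (HU D) + dim_row (HX D)"

definition Mset :: "ocp \<Rightarrow> nat set \<Rightarrow> nat set set" where
  "Mset D \<A> = {\<A>'. \<A>' \<subseteq> Qset D \<and> \<A>' \<inter> {..<qstage D} = \<A> \<inter> {..<qstage D}}"

definition Gamma_region :: "ocp \<Rightarrow> nat set \<Rightarrow> real vec set" where
  "Gamma_region D \<A> =
     (\<Union>\<A>' \<in> {\<A>' \<in> Mset D \<A>. full_row_rank (rows_of (Gmat D) \<A>')}. Pi_region D \<A>')"

definition G11 :: "ocp \<Rightarrow> real mat" where
  "G11 D = submatrix (Gmat D) {..<qstage D} {..<nu D}"

definition Kstar :: "ocp \<Rightarrow> nat set \<Rightarrow> real mat" where
  "Kstar D \<A> = (let \<A>s = \<A> \<inter> {..<qstage D} in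
     minv (rows_of (G11 D) \<A>s) * rows_of (Emat D) \<A>s)"

definition bstar :: "ocp \<Rightarrow> nat set \<Rightarrow> real vec" where
  "bstar D \<A> = (let \<A>s = \<A> \<inter> {..<qstage D} in
     minv (rows_of (G11 D) \<A>s) *\<^sub>v entries_of (wvec D) \<A>s)"

section \<open>The quadratic program and the optimal control problem agree\<close>

lemma sel_carrier [simp]: "sel D k \<in> carrier_mat (nu D) (nU D)"
  by (simp add: sel_def)

lemma msum_carrier [simp]: "msum r c f N \<in> carrier_mat r c"
  by (simp add: msum_def)

lemma Gam_carrier [simp]: "Gam D k \<in> carrier_mat (nx D) (nU D)"
  by (simp add: Gam_def)

lemma input_carrier [simp]: "input D U k \<in> carrier_vec (nu D)"
  by (simp add: input_def)

lemma input_eq: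
  assumes "k < hor D" "U \<in> carrier_vec (nU D)"
  shows "sel D k *\<^sub>v U = input D U k"
proof (rule eq_vecI)
  fix i assume "i < dim_vec (input D U k)"
  then have i: "i < nu D" by (simp add: input_def)
  have "k * nu D + i < Suc k * nu D" using i by simp
  also have "\<dots> \<le> hor D * nu D" using assms(1) by (intro mult_right_mono) auto
  finally have lt: "k * nu D + i < nU D" by (simp add: nU_def mult.commute)
  have "(sel D k *\<^sub>v U) $ i = (\<Sum>c<nU D. (if c = k * nu D + i then 1 else 0) * U $ c)"
    using i assms(2) by (simp add: sel_def scalar_prod_def atLeast0LessThan)
  also have "\<dots> = (\<Sum>c<nU D. if c = k * nu D + i then U $ c else 0)"
    by (intro sum.cong) auto
  also have "\<dots> = U $ (k * nu D + i)" using lt by simp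
  finally show "(sel D k *\<^sub>v U) $ i = input D U k $ i" using i by (simp add: input_def)
qed (simp add: sel_def input_def)

lemma msum_mult_vec:
  assumes f: "\<And>k. k < N \<Longrightarrow> f k \<in> carrier_mat r c" and u: "u \<in> carrier_vec c" and i: "i < r"
  shows "(msum r c f N *\<^sub>v u) $ i = (\<Sum>k<N. (f k *\<^sub>v u) $ i)"
proof -
  have "(msum r c f N *\<^sub>v u) $ i = (\<Sum>j<c. (\<Sum>k<N. f k $$ (i, j)) * u $ j)"
    using u i by (simp add: msum_def scalar_prod_def atLeast0LessThan)
  also have "\<dots> = (\<Sum>k<N. \<Sum>j<c. f k $$ (i, j) * u $ j)"
    unfolding sum_distrib_right by (rule sum.swap)
  also have "\<dots> = (\<Sum>k<N. (f k *\<^sub>v u) $ i)"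
  proof (rule sum.cong)
    fix k assume "k \<in> {..<N}"
    then have "f k \<in> carrier_mat r c" using f by simp
    then show "(\<Sum>j<c. f k $$ (i, j) * u $ j) = (f k *\<^sub>v u) $ i"
      using u i by (auto simp: scalar_prod_def atLeast0LessThan)
  qed simp
  finally show ?thesis .
qed

lemma scalar_prod_msum:
  assumes f: "\<And>k. k < N \<Longrightarrow> f k \<in> carrier_mat r c"
    and u: "u \<in> carrier_vec c" and v: "v \<in> carrier_vec r"
  shows "v \<bullet> (msum r c f N *\<^sub>v u) = (\<Sum>k<N. v \<bullet> (f k *\<^sub>v u))"
proof -
  have "v \<bullet> (msum r c f N *\<^sub>v u) = (\<Sum>i<r. v $ i * (\<Sum>k<N. (f k *\<^sub>v u) $ i))"
    unfolding scalar_prod_def[of v]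
    using msum_mult_vec[of N f r c u] f u
    by (auto simp: atLeast0LessThan carrier_matD(1)[OF msum_carrier] simp del: index_mult_mat_vec)
  also have "\<dots> = (\<Sum>k<N. \<Sum>i<r. v $ i * (f k *\<^sub>v u) $ i)"
    unfolding sum_distrib_left by (rule sum.swap)
  also have "\<dots> = (\<Sum>k<N. v \<bullet> (f k *\<^sub>v u))"
  proof (rule sum.cong)
    fix k assume "k \<in> {..<N}"
    then have "f k \<in> carrier_mat r c" using f by simp
    then show "(\<Sum>i<r. v $ i * (f k *\<^sub>v u) $ i) = v \<bullet> (f k *\<^sub>v u)"
      by (simp add: scalar_prod_def atLeast0LessThan)
  qed simp
  finally show ?thesis .
qed

lemma pow_mat_Suc_left:
  assumes "(A :: real mat) \<in> carrier_mat n n"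
  shows "A ^\<^sub>m Suc k = A * A ^\<^sub>m k"
proof (induction k)
  case (Suc k)
  have "A ^\<^sub>m Suc (Suc k) = (A * A ^\<^sub>m k) * A" using Suc by simp
  also have "\<dots> = A * (A ^\<^sub>m k * A)"
    using assms by (intro assoc_mult_mat[of _ n n _ n _ n]) auto
  finally show ?case by simp
qed (use assms in auto)

lemma Gam_mult_vec:
  assumes A: "Amat D \<in> carrier_mat (nx D) (nx D)" and B: "Bmat D \<in> carrier_mat (nx D) (nu D)"
    and U: "U \<in> carrier_vec (nU D)"
  shows "Gam D (Suc k) *\<^sub>v U = Amat D *\<^sub>v (Gam D k *\<^sub>v U) + Bmat D *\<^sub>v (sel D k *\<^sub>v U)"
proof -
  let ?A = "Amat D" and ?B = "Bmat D"
  have P: "\<And>j. ?A ^\<^sub>m j \<in> carrier_mat (nx D) (nx D)" using A by simp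
  have c: "\<And>k j. ?A ^\<^sub>m (k - 1 - j) * ?B * sel D j \<in> carrier_mat (nx D) (nU D)"
    by (rule mult_carrier_mat[OF mult_carrier_mat[OF P B] sel_carrier])
  have e: "?A ^\<^sub>m j * ?B * sel D i *\<^sub>v U = ?A ^\<^sub>m j *\<^sub>v (?B *\<^sub>v (sel D i *\<^sub>v U))" for i j
    using assoc_mult_mat_vec[OF mult_carrier_mat[OF P B] sel_carrier U, of j i]
      assoc_mult_mat_vec[OF P B mult_mat_vec_carrier[OF sel_carrier U], of j i] by simp
  let ?v = "\<lambda>j. ?B *\<^sub>v (sel D j *\<^sub>v U)"
  have v: "\<And>j. ?v j \<in> carrier_vec (nx D)"
    by (rule mult_mat_vec_carrier[OF B mult_mat_vec_carrier[OF sel_carrier U]])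
  have Gi: "(Gam D k *\<^sub>v U) $ i = (\<Sum>j<k. (?A ^\<^sub>m (k - 1 - j) *\<^sub>v ?v j) $ i)" if "i < nx D" for i k
    unfolding Gam_def using msum_mult_vec[OF c U that] e by simp
  show ?thesis
  proof (rule eq_vecI)
    fix i assume "i < dim_vec (?A *\<^sub>v (Gam D k *\<^sub>v U) + ?B *\<^sub>v (sel D k *\<^sub>v U))"
    then have i: "i < nx D" using B by simp
    have "(Gam D (Suc k) *\<^sub>v U) $ i = (\<Sum>j<k. (?A ^\<^sub>m (k - j) *\<^sub>v ?v j) $ i) + (?A ^\<^sub>m 0 *\<^sub>v ?v k) $ i"
      using Gi[OF i, of "Suc k"] by simp
    also have "?A ^\<^sub>m 0 *\<^sub>v ?v k = ?v k"
      using A v by (simp add: pow_mat.simps)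
    also have "(\<Sum>j<k. (?A ^\<^sub>m (k - j) *\<^sub>v ?v j) $ i) =
        (\<Sum>j<k. \<Sum>l<nx D. ?A $$ (i, l) * (?A ^\<^sub>m (k - 1 - j) *\<^sub>v ?v j) $ l)"
    proof (rule sum.cong)
      fix j assume "j \<in> {..<k}"
      then have "k - j = Suc (k - 1 - j)" by auto
      then have "?A ^\<^sub>m (k - j) = ?A * ?A ^\<^sub>m (k - 1 - j)" using pow_mat_Suc_left[OF A] by simp
      then have "?A ^\<^sub>m (k - j) *\<^sub>v ?v j = ?A *\<^sub>v (?A ^\<^sub>m (k - 1 - j) *\<^sub>v ?v j)"
        using assoc_mult_mat_vec[OF A P v] by simp
      then show "(?A ^\<^sub>m (k - j) *\<^sub>v ?v j) $ i =
          (\<Sum>l<nx D. ?A $$ (i, l) * (?A ^\<^sub>m (k - 1 - j) *\<^sub>v ?v j) $ l)"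
        using i A carrier_matD[OF P] by (simp add: scalar_prod_def atLeast0LessThan)
    qed simp
    also have "\<dots> = (\<Sum>l<nx D. ?A $$ (i, l) * (Gam D k *\<^sub>v U) $ l)"
      using Gi by (subst sum.swap) (simp add: sum_distrib_left)
    also have "\<dots> = (?A *\<^sub>v (Gam D k *\<^sub>v U)) $ i"
      using i A carrier_matD(1)[OF Gam_carrier[of D k]] by (simp add: scalar_prod_def atLeast0LessThan)
    finally show "(Gam D (Suc k) *\<^sub>v U) $ i = (?A *\<^sub>v (Gam D k *\<^sub>v U) + ?v k) $ i"
      using i carrier_vecD[OF v, of k] by (simp del: index_mult_mat_vec)
  qed (use B carrier_matD(1)[OF Gam_carrier[of D "Suc k"]] in simp)
qed

lemma state_eq:
  assumes A: "Amat D \<in> carrier_mat (nx D) (nx D)" and B: "Bmat D \<in> carrier_mat (nx D) (nu D)"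
    and x: "x \<in> carrier_vec (nx D)" and U: "U \<in> carrier_vec (nU D)" and k: "k \<le> hor D"
  shows "state D x U k = Phi D k *\<^sub>v x + Gam D k *\<^sub>v U"
  using k
proof (induction k)
  case 0
  have "Gam D 0 *\<^sub>v U = 0\<^sub>v (nx D)"
  proof (rule eq_vecI)
    fix i assume "i < dim_vec (0\<^sub>v (nx D) :: real vec)"
    then have i: "i < nx D" by simp
    show "(Gam D 0 *\<^sub>v U) $ i = 0\<^sub>v (nx D) $ i"
      unfolding Gam_def using i U by (subst msum_mult_vec) auto
  qed (use carrier_matD(1)[OF Gam_carrier[of D 0]] in simp)
  then show ?case using A x by (simp add: Phi_def)
next
  case (Suc k)
  have P: "Phi D k \<in> carrier_mat (nx D) (nx D)" using A by (simp add: Phi_def)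
  have Px: "Phi D k *\<^sub>v x \<in> carrier_vec (nx D)" by (rule mult_mat_vec_carrier[OF P x])
  have GU: "Gam D k *\<^sub>v U \<in> carrier_vec (nx D)" by (rule mult_mat_vec_carrier[OF Gam_carrier U])
  have "state D x U (Suc k) =
      Amat D *\<^sub>v (Phi D k *\<^sub>v x + Gam D k *\<^sub>v U) + Bmat D *\<^sub>v (sel D k *\<^sub>v U)"
    using Suc input_eq[OF _ U, of k] by simp
  also have "\<dots> = Amat D *\<^sub>v (Phi D k *\<^sub>v x) + (Amat D *\<^sub>v (Gam D k *\<^sub>v U) + Bmat D *\<^sub>v (sel D k *\<^sub>v U))"
    using mult_add_distrib_mat_vec[OF A Px GU] A B Px GU U
    by (subst mult_add_distrib_mat_vec[OF A Px GU], intro assoc_add_vec[of _ "nx D"])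
      (auto intro!: mult_mat_vec_carrier sel_carrier)
  also have "Amat D *\<^sub>v (Phi D k *\<^sub>v x) = Phi D (Suc k) *\<^sub>v x"
    using assoc_mult_mat_vec[OF A P x] pow_mat_Suc_left[OF A, of k] by (simp add: Phi_def)
  finally show ?case by (simp add: Gam_mult_vec[OF A B U])
qed

lemma scalar_prod_sandwich:
  assumes X: "X \<in> carrier_mat n a" and M: "M \<in> carrier_mat n n" and Z: "Z \<in> carrier_mat n b"
    and u: "u \<in> carrier_vec a" and v: "v \<in> carrier_vec b"
  shows "u \<bullet> ((X\<^sup>T * M * Z) *\<^sub>v v) = (X *\<^sub>v u) \<bullet> (M *\<^sub>v (Z *\<^sub>v (v :: real vec)))"
proof -
  have XT: "X\<^sup>T \<in> carrier_mat a n" using X by simp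
  have Zv: "Z *\<^sub>v v \<in> carrier_vec n" by (rule mult_mat_vec_carrier[OF Z v])
  have MZv: "M *\<^sub>v (Z *\<^sub>v v) \<in> carrier_vec n" by (rule mult_mat_vec_carrier[OF M Zv])
  have "(X\<^sup>T * M * Z) *\<^sub>v v = X\<^sup>T *\<^sub>v (M *\<^sub>v (Z *\<^sub>v v))"
    using assoc_mult_mat_vec[OF mult_carrier_mat[OF XT M] Z v] assoc_mult_mat_vec[OF XT M Zv] by simp
  then show ?thesis
    using transpose_vec_mult_scalar[OF X u MZv]
      comm_scalar_prod[OF u mult_mat_vec_carrier[OF XT MZv]]
      comm_scalar_prod[OF MZv mult_mat_vec_carrier[OF X u]] by simp
qed

lemma smult_mat_mult_vec:
  assumes "M \<in> carrier_mat a b" "v \<in> carrier_vec b"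
  shows "(r \<cdot>\<^sub>m M) *\<^sub>v v = r \<cdot>\<^sub>v (M *\<^sub>v (v :: real vec))"
  using assms by (intro eq_vecI) (auto simp: scalar_prod_def sum_distrib_left mult.assoc)

lemma quad_expand:
  assumes M: "M \<in> carrier_mat n n" "M\<^sup>T = M" and a: "a \<in> carrier_vec n" and b: "b \<in> carrier_vec n"
  shows "(a + b) \<bullet> (M *\<^sub>v (a + b)) =
    a \<bullet> (M *\<^sub>v a) + 2 * (a \<bullet> (M *\<^sub>v b)) + b \<bullet> (M *\<^sub>v (b :: real vec))"
proof -
  have Ma: "M *\<^sub>v a \<in> carrier_vec n" and Mb: "M *\<^sub>v b \<in> carrier_vec n"
    using M a b by auto
  have "b \<bullet> (M *\<^sub>v a) = a \<bullet> (M *\<^sub>v b)"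
    using transpose_vec_mult_scalar[OF M(1) a b] M(2) comm_scalar_prod[OF a Mb] comm_scalar_prod[OF b Ma]
    by simp
  then show ?thesis
    using mult_add_distrib_mat_vec[OF M(1) a b] add_scalar_prod_distrib[OF a b, of "M *\<^sub>v a + M *\<^sub>v b"]
      scalar_prod_add_distrib[OF a Ma Mb] scalar_prod_add_distrib[OF b Ma Mb] Ma Mb by simp
qed

theorem qp_cost_eq:
  assumes D: "standing_assumptions D"
    and x: "x \<in> carrier_vec (nx D)" and U: "U \<in> carrier_vec (nU D)"
  shows "qp_cost D x U = ocp_cost D x U"
proof -
  let ?N = "hor D" and ?P = "Pmat D" and ?Q = "Qmat D" and ?R = "Rmat D"
  let ?n = "nx D" and ?m = "nU D" and ?F = "Phi D" and ?G = "Gam D" and ?S = "sel D"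
  have A: "Amat D \<in> carrier_mat ?n ?n" and B: "Bmat D \<in> carrier_mat ?n (nu D)"
    and P: "?P \<in> carrier_mat ?n ?n" "?P\<^sup>T = ?P" and Q: "?Q \<in> carrier_mat ?n ?n" "?Q\<^sup>T = ?Q"
    and R: "?R \<in> carrier_mat (nu D) (nu D)"
    using D by (auto simp: standing_assumptions_def psd_def pd_def)
  have F: "\<And>k. ?F k \<in> carrier_mat ?n ?n" using A by (simp add: Phi_def)
  have Fx: "\<And>k. ?F k *\<^sub>v x \<in> carrier_vec ?n" by (rule mult_mat_vec_carrier[OF F x])
  have GU: "\<And>k. ?G k *\<^sub>v U \<in> carrier_vec ?n" by (rule mult_mat_vec_carrier[OF Gam_carrier U])
  have sandC: "\<And>X M Z n a b. X \<in> carrier_mat n a \<Longrightarrow> M \<in> carrier_mat n n \<Longrightarrow> Z \<in> carrier_mat n b \<Longrightarrow>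
      X\<^sup>T * M * (Z :: real mat) \<in> carrier_mat a b" by (meson mult_carrier_mat transpose_carrier_mat)
  have lin: "u \<bullet> ((2 \<cdot>\<^sub>m (X + Z)) *\<^sub>v v) = 2 * (u \<bullet> (X *\<^sub>v v) + u \<bullet> (Z *\<^sub>v v))"
    if "X \<in> carrier_mat a b" "Z \<in> carrier_mat a b" "u \<in> carrier_vec a" "v \<in> carrier_vec b"
    for X Z :: "real mat" and u v a b
  proof -
    have c: "X *\<^sub>v v \<in> carrier_vec a" "Z *\<^sub>v v \<in> carrier_vec a" using that by auto
    have "(2 \<cdot>\<^sub>m (X + Z)) *\<^sub>v v = 2 \<cdot>\<^sub>v (X *\<^sub>v v + Z *\<^sub>v v)"
      using that
      by (simp add: smult_mat_mult_vec[of _ a b] add_mult_distrib_mat_vec[of _ a b])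
    then show ?thesis using that c scalar_prod_add_distrib[OF that(3) c] by simp
  qed
  have H: "U \<bullet> (Hmat D *\<^sub>v U) = 2 * ((?G ?N *\<^sub>v U) \<bullet> (?P *\<^sub>v (?G ?N *\<^sub>v U)) +
     (\<Sum>k<?N. (?G k *\<^sub>v U) \<bullet> (?Q *\<^sub>v (?G k *\<^sub>v U)) + (?S k *\<^sub>v U) \<bullet> (?R *\<^sub>v (?S k *\<^sub>v U))))"
  proof -
    have s: "U \<bullet> (((?G k)\<^sup>T * ?Q * ?G k + (?S k)\<^sup>T * ?R * ?S k) *\<^sub>v U) =
       (?G k *\<^sub>v U) \<bullet> (?Q *\<^sub>v (?G k *\<^sub>v U)) + (?S k *\<^sub>v U) \<bullet> (?R *\<^sub>v (?S k *\<^sub>v U))" for k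
    proof -
      have c: "(?G k)\<^sup>T * ?Q * ?G k \<in> carrier_mat ?m ?m" "(?S k)\<^sup>T * ?R * ?S k \<in> carrier_mat ?m ?m"
        by (rule sandC[OF Gam_carrier Q(1) Gam_carrier], rule sandC[OF sel_carrier R sel_carrier])
      show ?thesis
        using add_mult_distrib_mat_vec[OF c U] scalar_prod_add_distrib[OF U, of "((?G k)\<^sup>T * ?Q * ?G k) *\<^sub>v U" "((?S k)\<^sup>T * ?R * ?S k) *\<^sub>v U"]
          mult_mat_vec_carrier[OF c(1) U] mult_mat_vec_carrier[OF c(2) U]
          scalar_prod_sandwich[OF Gam_carrier Q(1) Gam_carrier U U]
          scalar_prod_sandwich[OF sel_carrier R sel_carrier U U] by simp
    qed
    show ?thesis unfolding Hmat_def
      by (subst lin[OF sandC[OF Gam_carrier P(1) Gam_carrier] msum_carrier U U],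
          subst scalar_prod_msum[OF _ U U], 
          intro add_carrier_mat sandC[OF sel_carrier R sel_carrier])
         (simp only: s scalar_prod_sandwich[OF Gam_carrier P(1) Gam_carrier U U])
  qed
  have Fm: "x \<bullet> (Fmat D *\<^sub>v U) = 2 * ((?F ?N *\<^sub>v x) \<bullet> (?P *\<^sub>v (?G ?N *\<^sub>v U)) +
     (\<Sum>k<?N. (?F k *\<^sub>v x) \<bullet> (?Q *\<^sub>v (?G k *\<^sub>v U))))"
    unfolding Fmat_def
    by (subst lin[OF sandC[OF F P(1) Gam_carrier] msum_carrier x U],
        subst scalar_prod_msum[OF _ U x], rule sandC[OF F Q(1) Gam_carrier])
      (simp only: scalar_prod_sandwich[OF F P(1) Gam_carrier x U] scalar_prod_sandwich[OF F Q(1) Gam_carrier x U])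
  have Y: "x \<bullet> (Ymat D *\<^sub>v x) = 2 * ((?F ?N *\<^sub>v x) \<bullet> (?P *\<^sub>v (?F ?N *\<^sub>v x)) +
     (\<Sum>k<?N. (?F k *\<^sub>v x) \<bullet> (?Q *\<^sub>v (?F k *\<^sub>v x))))"
    unfolding Ymat_def
    by (subst lin[OF sandC[OF F P(1) F] msum_carrier x x],
        subst scalar_prod_msum[OF _ x x], rule sandC[OF F Q(1) F])
      (simp only: scalar_prod_sandwich[OF F P(1) F x x] scalar_prod_sandwich[OF F Q(1) F x x])
  have st: "\<And>k. k \<le> ?N \<Longrightarrow> state D x U k = ?F k *\<^sub>v x + ?G k *\<^sub>v U"
    by (rule state_eq[OF A B x U])
  have "ocp_cost D x U =
     (?F ?N *\<^sub>v x + ?G ?N *\<^sub>v U) \<bullet> (?P *\<^sub>v (?F ?N *\<^sub>v x + ?G ?N *\<^sub>v U)) +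
     (\<Sum>k<?N. (?F k *\<^sub>v x + ?G k *\<^sub>v U) \<bullet> (?Q *\<^sub>v (?F k *\<^sub>v x + ?G k *\<^sub>v U)) +
        (?S k *\<^sub>v U) \<bullet> (?R *\<^sub>v (?S k *\<^sub>v U)))"
    by (simp add: ocp_cost_def st input_eq[OF _ U])
  also have "\<dots> = qp_cost D x U"
    unfolding qp_cost_def H Fm Y quad_expand[OF P Fx GU] quad_expand[OF Q Fx GU]
    by (simp add: sum.distrib sum_distrib_left algebra_simps)
  finally show ?thesis by simp
qed

text \<open>The list of inequalities \<open>g \<bullet> U \<le> w + e \<bullet> x\<close>.\<close>

definition ineqs :: "real vec \<Rightarrow> real vec \<Rightarrow> real vec list \<Rightarrow> real list \<Rightarrow> real vec list \<Rightarrow> bool" where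
  "ineqs U x gs ws es \<longleftrightarrow>
     list_all2 (\<le>) (map (\<lambda>g. g \<bullet> U) gs) (map2 (+) ws (map (\<lambda>e. e \<bullet> x) es))"

lemma ineqs_append:
  assumes "length gs = length ws" "length es = length ws"
  shows "ineqs U x (gs @ gs') (ws @ ws') (es @ es') \<longleftrightarrow> ineqs U x gs ws es \<and> ineqs U x gs' ws' es'"
  using assms by (simp add: ineqs_def list_all2_append)

lemma ineqs_concat:
  assumes "\<And>k. k \<in> set ks \<Longrightarrow> length (g k) = length (w k) \<and> length (e k) = length (w k)"
  shows "length (concat (map g ks)) = length (concat (map w ks))"
    "length (concat (map e ks)) = length (concat (map w ks))"
    "ineqs U x (concat (map g ks)) (concat (map w ks)) (concat (map e ks)) \<longleftrightarrow>
       (\<forall>k\<in>set ks. ineqs U x (g k) (w k) (e k))"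
proof -
  have "length (concat (map g ks)) = length (concat (map w ks)) \<and>
    length (concat (map e ks)) = length (concat (map w ks)) \<and>
    (ineqs U x (concat (map g ks)) (concat (map w ks)) (concat (map e ks)) \<longleftrightarrow>
       (\<forall>k\<in>set ks. ineqs U x (g k) (w k) (e k)))"
    using assms
  proof (induction ks)
    case Nil then show ?case by (simp add: ineqs_def)
  next
    case (Cons k ks)
    then show ?case by (simp add: ineqs_append)
  qed
  then show "length (concat (map g ks)) = length (concat (map w ks))"
    "length (concat (map e ks)) = length (concat (map w ks))"
    "ineqs U x (concat (map g ks)) (concat (map w ks)) (concat (map e ks)) \<longleftrightarrow>
       (\<forall>k\<in>set ks. ineqs U x (g k) (w k) (e k))" by auto
qed

lemma mat_of_rows_ineqs:
  assumes "length gs = length ws" "length es = length ws"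
    "\<forall>g\<in>set gs. g \<in> carrier_vec a" "\<forall>e\<in>set es. e \<in> carrier_vec b"
  shows "mat_of_rows a gs *\<^sub>v U \<le> vec_of_list ws + mat_of_rows b es *\<^sub>v x \<longleftrightarrow> ineqs U x gs ws es"
  using assms by (auto simp: less_eq_vec_def ineqs_def list_all2_conv_all_nth vec_of_list_index)

lemma ineqs_rows:
  assumes "M \<in> carrier_mat r a" "L \<in> carrier_mat r b" "h \<in> carrier_vec r"
  shows "ineqs U x (rows M) (list_of_vec h) (rows L) \<longleftrightarrow> M *\<^sub>v U \<le> h + L *\<^sub>v x"
  using assms by (auto simp: less_eq_vec_def ineqs_def list_all2_conv_all_nth list_of_vec_index)

theorem qp_feasible_iff:
  assumes D: "standing_assumptions D"
    and x: "x \<in> carrier_vec (nx D)" and U: "U \<in> carrier_vec (nU D)"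
  shows "qp_feasible D x U \<longleftrightarrow> ocp_feasible D x U"
proof -
  let ?N = "hor D"
  have A: "Amat D \<in> carrier_mat (nx D) (nx D)" and B: "Bmat D \<in> carrier_mat (nx D) (nu D)"
    and X: "HX D \<in> carrier_mat (dim_vec (hX D)) (nx D)"
    and Uc: "HU D \<in> carrier_mat (dim_vec (hU D)) (nu D)"
    and T: "HT D \<in> carrier_mat (dim_vec (hT D)) (nx D)"
    and N: "?N \<ge> 2"
    using D by (auto simp: standing_assumptions_def polytope_around_0_def)
  have S: "HS D k \<in> carrier_mat (dim_vec (hS D k)) (nx D)" for k
    using X T by (simp add: HS_def hS_def)
  have F: "\<And>k. Phi D k \<in> carrier_mat (nx D) (nx D)" using A by (simp add: Phi_def)
  let ?g = "\<lambda>k. rows (HU D * sel D k) @ rows (HS D (Suc k) * Gam D (Suc k))"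
  let ?w = "\<lambda>k. list_of_vec (hU D) @ list_of_vec (hS D (Suc k))"
  let ?e = "\<lambda>k. rows (0\<^sub>m (dim_row (HU D)) (nx D)) @ rows (- (HS D (Suc k) * Phi D (Suc k)))"
  have len: "\<And>k. length (?g k) = length (?w k) \<and> length (?e k) = length (?w k)"
    using Uc S by auto
  have cg: "\<forall>v\<in>set (concat (map ?g [0..<?N]) @ rows (0\<^sub>m (dim_row (HX D)) (nU D))). v \<in> carrier_vec (nU D)"
    using rows_carrier[of "0\<^sub>m (dim_row (HX D)) (nU D) :: real mat"]
      rows_carrier[of "HU D * sel D k" for k] rows_carrier[of "HS D k * Gam D k" for k]
      carrier_matD(2)[OF sel_carrier[of D]] carrier_matD(2)[OF Gam_carrier[of D]]
    by (simp add: subset_iff) blast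
  have ce: "\<forall>v\<in>set (concat (map ?e [0..<?N]) @ rows (- HX D)). v \<in> carrier_vec (nx D)"
    using rows_carrier[of "0\<^sub>m (dim_row (HU D)) (nx D) :: real mat"]
      rows_carrier[of "- (HS D k * Phi D k)" for k] rows_carrier[of "- HX D"]
      carrier_matD(2)[OF F] carrier_matD(2)[OF X]
    by (simp add: subset_iff) blast
  note cc = ineqs_concat[of "[0..<?N]" ?g ?w ?e, OF len]
  have u: "sel D k *\<^sub>v U \<in> carrier_vec (nu D)" for k by (rule mult_mat_vec_carrier[OF sel_carrier U])
  have gu: "Gam D k *\<^sub>v U \<in> carrier_vec (nx D)" for k by (rule mult_mat_vec_carrier[OF Gam_carrier U])
  have fx: "Phi D k *\<^sub>v x \<in> carrier_vec (nx D)" for k by (rule mult_mat_vec_carrier[OF F x])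
  have Ustep: "ineqs U x (rows (HU D * sel D k)) (list_of_vec (hU D)) (rows (0\<^sub>m (dim_row (HU D)) (nx D)))
     \<longleftrightarrow> input D U k \<in> Uset D" if "k < ?N" for k
  proof -
    have "ineqs U x (rows (HU D * sel D k)) (list_of_vec (hU D)) (rows (0\<^sub>m (dim_row (HU D)) (nx D)))
       \<longleftrightarrow> (HU D * sel D k) *\<^sub>v U \<le> hU D + 0\<^sub>m (dim_row (HU D)) (nx D) *\<^sub>v x"
      using Uc by (intro ineqs_rows[of _ "dim_vec (hU D)" "nU D" _ "nx D"])
        (auto intro: mult_carrier_mat[OF Uc sel_carrier] simp del: assoc_mult_mat)
    also have "(HU D * sel D k) *\<^sub>v U = HU D *\<^sub>v input D U k"
      using assoc_mult_mat_vec[OF Uc sel_carrier U] input_eq[OF that U] by simp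
    also have "hU D + 0\<^sub>m (dim_row (HU D)) (nx D) *\<^sub>v x = hU D"
      using x Uc by (intro eq_vecI) auto
    finally show ?thesis by (simp add: Uset_def polyhedron_def)
  qed
  have Sstep: "ineqs U x (rows (HS D k * Gam D k)) (list_of_vec (hS D k)) (rows (- (HS D k * Phi D k)))
     \<longleftrightarrow> state D x U k \<in> polyhedron (nx D) (HS D k) (hS D k)" if "k \<le> ?N" for k
  proof -
    have SF: "HS D k * Phi D k \<in> carrier_mat (dim_vec (hS D k)) (nx D)" by (rule mult_carrier_mat[OF S F])
    have "ineqs U x (rows (HS D k * Gam D k)) (list_of_vec (hS D k)) (rows (- (HS D k * Phi D k)))
       \<longleftrightarrow> (HS D k * Gam D k) *\<^sub>v U \<le> hS D k + (- (HS D k * Phi D k)) *\<^sub>v x"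
      using SF by (intro ineqs_rows[of _ "dim_vec (hS D k)" "nU D" _ "nx D"])
        (auto intro: mult_carrier_mat[OF S Gam_carrier])
    also have "(HS D k * Gam D k) *\<^sub>v U = HS D k *\<^sub>v (Gam D k *\<^sub>v U)"
      by (rule assoc_mult_mat_vec[OF S Gam_carrier U])
    also have "(- (HS D k * Phi D k)) *\<^sub>v x = - (HS D k *\<^sub>v (Phi D k *\<^sub>v x))"
      using SF x assoc_mult_mat_vec[OF S F x, of k] by (metis uminus_mult_mat_vec carrier_matD(2) carrier_vecD)
    also have "HS D k *\<^sub>v (Gam D k *\<^sub>v U) \<le> hS D k + - (HS D k *\<^sub>v (Phi D k *\<^sub>v x)) \<longleftrightarrow>
       HS D k *\<^sub>v (Phi D k *\<^sub>v x) + HS D k *\<^sub>v (Gam D k *\<^sub>v U) \<le> hS D k"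
      using S[of k] by (auto simp: less_eq_vec_def algebra_simps simp del: index_mult_mat_vec)
    also have "HS D k *\<^sub>v (Phi D k *\<^sub>v x) + HS D k *\<^sub>v (Gam D k *\<^sub>v U) = HS D k *\<^sub>v state D x U k"
      using mult_add_distrib_mat_vec[OF S fx gu, of k k k] state_eq[OF A B x U that] by simp
    finally show ?thesis using fx gu state_eq[OF A B x U that] by (simp add: polyhedron_def)
  qed
  have X0: "ineqs U x (rows (0\<^sub>m (dim_row (HX D)) (nU D))) (list_of_vec (hX D)) (rows (- HX D))
     \<longleftrightarrow> x \<in> Xset D"
  proof -
    have "ineqs U x (rows (0\<^sub>m (dim_row (HX D)) (nU D))) (list_of_vec (hX D)) (rows (- HX D))
       \<longleftrightarrow> 0\<^sub>m (dim_row (HX D)) (nU D) *\<^sub>v U \<le> hX D + (- HX D) *\<^sub>v x"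
      using X by (intro ineqs_rows[of _ "dim_vec (hX D)" "nU D" _ "nx D"]) auto
    also have "0\<^sub>m (dim_row (HX D)) (nU D) *\<^sub>v U = 0\<^sub>v (dim_vec (hX D))"
      using U X by (intro eq_vecI) auto
    also have "(- HX D) *\<^sub>v x = - (HX D *\<^sub>v x)"
      using X x by (metis uminus_mult_mat_vec carrier_matD(2) carrier_vecD)
    also have "0\<^sub>v (dim_vec (hX D)) \<le> hX D + - (HX D *\<^sub>v x) \<longleftrightarrow> HX D *\<^sub>v x \<le> hX D"
      using X by (auto simp: less_eq_vec_def simp del: index_mult_mat_vec)
    finally show ?thesis using x by (simp add: Xset_def polyhedron_def)
  qed
  have step: "ineqs U x (?g k) (?w k) (?e k) \<longleftrightarrow>
     input D U k \<in> Uset D \<and> state D x U (Suc k) \<in> polyhedron (nx D) (HS D (Suc k)) (hS D (Suc k))"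
    if "k < ?N" for k
    using Ustep[OF that] Sstep[of "Suc k"] that Uc by (subst ineqs_append) auto
  have "qp_feasible D x U \<longleftrightarrow> (\<forall>k<?N. ineqs U x (?g k) (?w k) (?e k)) \<and> x \<in> Xset D"
    unfolding qp_feasible_def Gmat_def wvec_def Emat_def
    using U cc X
    by (subst mat_of_rows_ineqs[OF _ _ cg ce]) (auto simp: ineqs_append X0[unfolded carrier_matD(1)[OF X]])
  also have "\<dots> \<longleftrightarrow> ocp_feasible D x U"
  proof -
    have "(\<forall>k<?N. state D x U (Suc k) \<in> polyhedron (nx D) (HS D (Suc k)) (hS D (Suc k))) \<and> x \<in> Xset D \<longleftrightarrow>
       (\<forall>k<?N. state D x U k \<in> Xset D) \<and> state D x U ?N \<in> Tset D" (is "?L \<longleftrightarrow> ?R")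
    proof
      assume L: ?L
      have "state D x U k \<in> Xset D" if "k < ?N" for k
        using L that by (cases k) (auto simp: HS_def hS_def Xset_def dest!: spec[of _ "k - 1"])
      moreover have "state D x U ?N \<in> Tset D"
        using L N by (cases ?N) (auto simp: HS_def hS_def Tset_def)
      ultimately show ?R by blast
    next
      assume R: ?R
      have "state D x U (Suc k) \<in> polyhedron (nx D) (HS D (Suc k)) (hS D (Suc k))" if "k < ?N" for k
        using R that by (cases "Suc k = ?N") (auto simp: HS_def hS_def Xset_def Tset_def simp del: state.simps(2))
      moreover have "x \<in> Xset D" using R N by (auto dest: spec[of _ 0])
      ultimately show ?L by blast
    qed
    then show ?thesis using step by (auto simp: ocp_feasible_def)
  qed
  finally show ?thesis .
qed

end

theory Submission
  imports Defs
begin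

text \<open>
  The quadratic program is strictly convex: \<open>H\<close> is positive definite, because at \<open>x = 0\<close> its
  quadratic form is the cost of steering with \<open>U\<close>, which is at least the input cost weighted by
  the positive definite \<open>R\<close> (\<open>Hmat_pd\<close>).  Hence a feasible point that satisfies
  the Karush-Kuhn-Tucker conditions is the unique solution (\<open>quadratic_growth_of_KKT\<close>).

  Fix an index set \<open>\<A>'\<close> with \<open>G\<^sub>A\<close> of full row rank and solve the conditions with
  precisely the constraints in \<open>\<A>'\<close> imposed as equalities.  Stationarity
  \<open>H U + F\<^sup>T x = G\<^sub>A\<^sup>T \<mu>\<close> and \<open>G\<^sub>A U = w\<^sub>A + E\<^sub>A x\<close> force \<open>\<mu> = W (w\<^sub>A + S\<^sub>A x)\<close>
  (\<open>multiplier_stationary\<close>; the inverse \<open>W\<close> exists by \<open>gram_minv\<close>).  The two blocks of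
  \<open>T x \<le> d\<close> that define \<open>\<Pi>(\<A>')\<close> say that \<open>\<mu> \<le> 0\<close>, and that
  the remaining inequalities hold at this \<open>U\<close> (\<open>Pi_region_inequalities\<close>).  So on
  \<open>\<Pi>(\<A>')\<close> the point \<open>U\<close> is the optimum, and every constraint in \<open>\<A>'\<close> is active at
  it (\<open>Pi_region_solution\<close>).

  The inequalities of the first stage concern \<open>u 0\<close> and \<open>x 1 = A x + B u 0\<close>, so in the first
  \<open>qstage\<close> rows of \<open>G\<close> only the columns of \<open>u 0\<close> are nonzero (\<open>Gmat_stage_rows\<close>; here the horizon
  is at least 2, so that \<open>x 1\<close> is not yet the terminal state).  The active constraints of the first stage
  are therefore a linear system for \<open>u 0\<close> alone.  Its coefficient matrix is the same for
  all \<open>\<A>'\<close> in \<open>\<M>(\<A>)\<close>, and if it is invertible, it determines \<open>u 0\<close> as the stated affine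
  function of \<open>x\<close> (\<open>first_input_of_active_stage\<close>).
\<close>

section \<open>Selecting rows and entries\<close>

text \<open>\<open>pick I\<close> enumerates \<open>I\<close> increasingly, so that statements about all entries of a selected
  subvector become statements about all indices in \<open>I\<close>.\<close>

lemma pick_image:
  "pick I ` {..<card {i. i < n \<and> i \<in> I}} = {i. i < n \<and> i \<in> I}" (is "pick I ` {..<card ?S} = ?S")
proof (intro equalityI subsetI)
  fix i assume "i \<in> pick I ` {..<card ?S}"
  then obtain k where k: "k < card ?S" "i = pick I k" by auto
  then show "i \<in> ?S" using pick_reduce_set[of k n I] pick_in_set[of k ?S] by simp
next
  fix i assume i: "i \<in> ?S"
  have "{a \<in> I. a < i} \<subset> ?S" using i by auto
  then have "card {a \<in> I. a < i} < card ?S" by (intro psubset_card_mono) auto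
  moreover have "pick I (card {a \<in> I. a < i}) = i" using i by (intro pick_card_in_set) auto
  ultimately show "i \<in> pick I ` {..<card ?S}" by (intro image_eqI[where x = "card {a \<in> I. a < i}"]) auto
qed

lemma entries_of_carrier: "dim_vec v = n \<Longrightarrow> entries_of v I \<in> carrier_vec (card {i. i < n \<and> i \<in> I})"
  by (auto simp: entries_of_def)

lemma entries_of_index:
  "k < card {i. i < dim_vec v \<and> i \<in> I} \<Longrightarrow> entries_of v I $ k = v $ pick I k"
  by (simp add: entries_of_def)

lemma entries_of_le_iff:
  assumes "dim_vec u = n" "dim_vec v = n"
  shows "entries_of u I \<le> entries_of v I \<longleftrightarrow> (\<forall>i<n. i \<in> I \<longrightarrow> u $ i \<le> v $ i)"
proof -
  have "entries_of u I \<le> entries_of v I \<longleftrightarrow>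
      (\<forall>k \<in> {..<card {i. i < n \<and> i \<in> I}}. u $ pick I k \<le> v $ pick I k)"
    using assms by (simp add: less_eq_vec_def entries_of_def Ball_def)
  also have "\<dots> \<longleftrightarrow> (\<forall>i \<in> pick I ` {..<card {i. i < n \<and> i \<in> I}}. u $ i \<le> v $ i)"
    by (simp only: ball_simps)
  also have "\<dots> \<longleftrightarrow> (\<forall>i<n. i \<in> I \<longrightarrow> u $ i \<le> v $ i)"
    unfolding pick_image by blast
  finally show ?thesis .
qed

lemma entries_of_eq_iff:
  assumes "dim_vec u = n" "dim_vec v = n"
  shows "entries_of u I = entries_of v I \<longleftrightarrow> (\<forall>i<n. i \<in> I \<longrightarrow> u $ i = v $ i)"
proof -
  have "entries_of u I = entries_of v I \<longleftrightarrow>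
      entries_of u I \<le> entries_of v I \<and> entries_of v I \<le> entries_of u I"
    by (rule order.eq_iff)
  also have "\<dots> \<longleftrightarrow> (\<forall>i<n. i \<in> I \<longrightarrow> u $ i = v $ i)"
    unfolding entries_of_le_iff[OF assms] entries_of_le_iff[OF assms(2,1)]
    using order.eq_iff[where ?'a = real] by metis
  finally show ?thesis .
qed

lemma entries_of_add:
  assumes "dim_vec u = dim_vec v"
  shows "entries_of (u + v) I = entries_of u I + entries_of v I"
proof (rule eq_vecI)
  fix k assume "k < dim_vec (entries_of u I + entries_of v I)"
  then have k: "k < card {i. i < dim_vec v \<and> i \<in> I}" by (simp add: entries_of_def)
  show "entries_of (u + v) I $ k = (entries_of u I + entries_of v I) $ k"
    using k pick_le[OF k] assms by (simp add: entries_of_def)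
qed (use assms in \<open>simp add: entries_of_def\<close>)

lemma rows_of_carrier:
  "M \<in> carrier_mat r c \<Longrightarrow> rows_of M I \<in> carrier_mat (card {i. i < r \<and> i \<in> I}) c"
  by (auto simp: rows_of_def submatrix_def)

lemma rows_of_mult_vec:
  assumes "M \<in> carrier_mat r c" "v \<in> carrier_vec c"
  shows "rows_of M I *\<^sub>v v = entries_of (M *\<^sub>v v) I"
proof (rule eq_vecI)
  fix k assume "k < dim_vec (entries_of (M *\<^sub>v v) I)"
  then have k: "k < card {i. i < r \<and> i \<in> I}" using assms by (simp add: entries_of_def)
  have "row (rows_of M I) k = row M (pick I k)"
    using k pick_le[of k r I] assms by (intro eq_vecI) (auto simp: rows_of_def submatrix_def pick_UNIV)
  then show "(rows_of M I *\<^sub>v v) $ k = entries_of (M *\<^sub>v v) I $ k"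
    using k pick_le[of k r I] assms by (simp add: entries_of_def rows_of_def submatrix_def)
qed (use assms in \<open>simp add: rows_of_def submatrix_def entries_of_def\<close>)

section \<open>Invertibility\<close>

lemma minv_inverse:
  assumes M: "M \<in> carrier_mat n n"
    and ker: "\<And>v. v \<in> carrier_vec n \<Longrightarrow> M *\<^sub>v v = 0\<^sub>v n \<Longrightarrow> v = 0\<^sub>v n"
  shows "minv M \<in> carrier_mat n n" "M * minv M = 1\<^sub>m n" "minv M * M = 1\<^sub>m n"
proof -
  have "det M \<noteq> 0" using det_0_iff_vec_prod_zero_field[OF M] ker by auto
  then have "mat_inverse M \<noteq> None"
    using mat_inverse(1)[OF M, of "()"] det_non_zero_imp_unit[OF M, of "()"] by blast
  then obtain B where B: "mat_inverse M = Some B" by auto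
  show "minv M \<in> carrier_mat n n" "M * minv M = 1\<^sub>m n" "minv M * M = 1\<^sub>m n"
    using mat_inverse(2)[OF M B] B by (auto simp: minv_def)
qed

lemma invertible_mat_kernel:
  assumes "invertible_mat M" "M \<in> carrier_mat n n" "v \<in> carrier_vec n" "M *\<^sub>v v = 0\<^sub>v n"
  shows "v = 0\<^sub>v n"
proof -
  obtain B where B: "M * B = 1\<^sub>m n" "B * M = 1\<^sub>m (dim_row B)"
    using assms by (auto simp: invertible_mat_def inverts_mat_def)
  have Bc: "B \<in> carrier_mat n n"
    using assms(2) arg_cong[OF B(1), of dim_col] arg_cong[OF B(2), of dim_col]
    by (intro carrier_matI) simp_all
  have "v = (B * M) *\<^sub>v v" using B(2) Bc assms(3) by simp
  also have "\<dots> = B *\<^sub>v 0\<^sub>v n" using assoc_mult_mat_vec[OF Bc assms(2,3)] assms(4) by simp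
  also have "\<dots> = 0\<^sub>v n" using Bc by (intro eq_vecI) auto
  finally show ?thesis .
qed

text \<open>Full row rank is the rank of the columns, so as many columns as there are rows can be
  chosen to be independent.  They form an invertible square matrix, and its transpose annihilates no
  nonzero vector.\<close>

lemma full_row_rank_transpose_kernel:
  assumes M: "M \<in> carrier_mat r c" and full: "full_row_rank M"
    and y: "y \<in> carrier_vec r" and My: "M\<^sup>T *\<^sub>v y = 0\<^sub>v c"
  shows "y = 0\<^sub>v r"
proof -
  interpret vec_space "TYPE(real)" r .
  have "lin_indpt {}" by (simp add: lin_dep_def)
  then obtain S where S: "maximal S (\<lambda>T. T \<subseteq> set (cols M) \<and> lin_indpt T)"
    using maximal_exists_superset[of "set (cols M)" "\<lambda>T. T \<subseteq> set (cols M) \<and> lin_indpt T" "{}"] by auto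
  then have SM: "S \<subseteq> set (cols M)" and Sl: "lin_indpt S" by (auto simp: maximal_def)
  have cS: "card S = r"
    using rank_card_indpt[OF M S] full M by (simp add: full_row_rank_def)
  obtain xs where xs: "set xs = S" "distinct xs"
    using finite_distinct_list[of S] SM finite_subset by blast
  define N where "N = mat_of_cols r xs"
  have len: "length xs = r" using xs cS distinct_card by fastforce
  have N: "N \<in> carrier_mat r r" using len by (auto simp: N_def)
  have xsc: "set xs \<subseteq> carrier_vec r" using xs(1) SM cols_dim M by blast
  have cN: "cols N = xs" unfolding N_def using xsc by (rule cols_mat_of_cols)
  have "det N \<noteq> 0"
    using lin_indpt_full_rank[OF N] cN xs Sl det_rank_iff[OF N] by simp
  then have dT: "det N\<^sup>T \<noteq> 0" using det_transpose[OF N] by simp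
  have "N\<^sup>T *\<^sub>v y = 0\<^sub>v r"
  proof (rule eq_vecI)
    fix i assume "i < dim_vec (0\<^sub>v r :: real vec)"
    then have i: "i < r" by simp
    then have "xs ! i \<in> set (cols M)" using SM xs(1) len nth_mem by blast
    then obtain j where j: "j < c" "xs ! i = col M j"
      using M by (auto simp: cols_def)
    have "col N i = xs ! i" using cN i N by (metis carrier_matD(2) cols_nth)
    then have "(N\<^sup>T *\<^sub>v y) $ i = (M\<^sup>T *\<^sub>v y) $ j" using i j N M by simp
    then show "(N\<^sup>T *\<^sub>v y) $ i = 0\<^sub>v r $ i" using My i j by simp
  qed (use N in simp)
  then show ?thesis
    using det_0_iff_vec_prod_zero_field[of "N\<^sup>T" r] N dT y by auto
qed

lemma pd_kernel:
  assumes "pd n M" "v \<in> carrier_vec n" "v \<bullet> (M *\<^sub>v v) \<le> 0"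
  shows "v = 0\<^sub>v n"
  using assms unfolding pd_def by force

lemma pd_minv:
  assumes "pd n M"
  shows "minv M \<in> carrier_mat n n" "M * minv M = 1\<^sub>m n"
proof -
  have M: "M \<in> carrier_mat n n" using assms by (simp add: pd_def)
  have "v = 0\<^sub>v n" if "v \<in> carrier_vec n" "M *\<^sub>v v = 0\<^sub>v n" for v
    using pd_kernel[OF assms that(1)] that by simp
  from minv_inverse[OF M this]
  show "minv M \<in> carrier_mat n n" "M * minv M = 1\<^sub>m n" by auto
qed

text \<open>If the Gram matrix \<open>G H\<^sup>-\<^sup>1 G\<^sup>T\<close> kills \<open>y\<close>, then \<open>p = H\<^sup>-\<^sup>1 G\<^sup>T y\<close> satisfies
  \<open>p \<bullet> H p = y \<bullet> G p = 0\<close>, so \<open>G\<^sup>T y = H p = 0\<close> and \<open>y = 0\<close> by full row rank.  For a matrix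
  without rows, \<open>W\<close> is the empty matrix.\<close>

lemma gram_minv:
  assumes H: "pd m H" and G: "G \<in> carrier_mat a m" and full: "full_row_rank G"
  defines "W \<equiv> minv (G * minv H * G\<^sup>T)"
  shows "W \<in> carrier_mat a a" "G * minv H * G\<^sup>T * W = 1\<^sub>m a"
proof -
  note Hi = pd_minv[OF H]
  have Hc: "H \<in> carrier_mat m m" using H by (simp add: pd_def)
  have GT: "G\<^sup>T \<in> carrier_mat m a" using G by simp
  have K: "G * minv H * G\<^sup>T \<in> carrier_mat a a"
    by (rule mult_carrier_mat[OF mult_carrier_mat[OF G Hi(1)] GT])
  have ker: "y = 0\<^sub>v a" if y: "y \<in> carrier_vec a" and 0: "(G * minv H * G\<^sup>T) *\<^sub>v y = 0\<^sub>v a" for y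
  proof -
    define p where "p = minv H *\<^sub>v (G\<^sup>T *\<^sub>v y)"
    have Gy: "G\<^sup>T *\<^sub>v y \<in> carrier_vec m" by (rule mult_mat_vec_carrier[OF GT y])
    have p: "p \<in> carrier_vec m" unfolding p_def by (rule mult_mat_vec_carrier[OF Hi(1) Gy])
    have Hp: "H *\<^sub>v p = G\<^sup>T *\<^sub>v y"
      unfolding p_def using assoc_mult_mat_vec[OF Hc Hi(1) Gy] Hi(2) Gy by simp
    have Gp: "G *\<^sub>v p = 0\<^sub>v a"
      using 0 assoc_mult_mat_vec[OF mult_carrier_mat[OF G Hi(1)] GT y]
        assoc_mult_mat_vec[OF G Hi(1) Gy] by (simp add: p_def)
    have "p \<bullet> (H *\<^sub>v p) = y \<bullet> (G *\<^sub>v p)"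
      unfolding Hp using transpose_vec_mult_scalar[OF G p y] comm_scalar_prod[OF p Gy] by simp
    also have "\<dots> = 0" using Gp y by simp
    finally have "p = 0\<^sub>v m" using pd_kernel[OF H p] by simp
    then have "G\<^sup>T *\<^sub>v y = 0\<^sub>v m" using Hp Hc by (intro eq_vecI) (auto simp flip: Hp)
    then show ?thesis by (rule full_row_rank_transpose_kernel[OF G full y])
  qed
  show "W \<in> carrier_mat a a" "G * minv H * G\<^sup>T * W = 1\<^sub>m a"
    unfolding W_def using minv_inverse[OF K ker] by auto
qed

section \<open>Karush-Kuhn-Tucker points of a strictly convex quadratic program\<close>

text \<open>The stationary point of \<open>1/2 U \<bullet> H U + c \<bullet> U\<close> on the affine subspace \<open>G\<^sub>A U = b\<close>.
  The multiplier \<open>\<mu>\<close> is the negative of the usual one, which is nonnegative for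
  inequalities \<open>G\<^sub>A U \<le> b\<close>; this saves the minus signs in front of \<open>W\<close>.\<close>

lemma multiplier_stationary:
  assumes H: "pd m H" and GA: "GA \<in> carrier_mat a m" and full: "full_row_rank GA"
    and b: "b \<in> carrier_vec a" and c: "c \<in> carrier_vec m"
  defines "\<mu> \<equiv> minv (GA * minv H * GA\<^sup>T) *\<^sub>v (b + GA *\<^sub>v (minv H *\<^sub>v c))"
  defines "U \<equiv> minv H *\<^sub>v (GA\<^sup>T *\<^sub>v \<mu>) - minv H *\<^sub>v c"
  shows "\<mu> \<in> carrier_vec a" "U \<in> carrier_vec m"
    "H *\<^sub>v U + c = GA\<^sup>T *\<^sub>v \<mu>" "GA *\<^sub>v U = b"
proof -
  note Hi = pd_minv[OF H] and W = gram_minv[OF H GA full]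
  have Hc: "H \<in> carrier_mat m m" using H by (simp add: pd_def)
  have GT: "GA\<^sup>T \<in> carrier_mat m a" using GA by simp
  have Hic: "minv H *\<^sub>v c \<in> carrier_vec m" by (rule mult_mat_vec_carrier[OF Hi(1) c])
  have z: "b + GA *\<^sub>v (minv H *\<^sub>v c) \<in> carrier_vec a" (is "?z \<in> _")
    using b mult_mat_vec_carrier[OF GA Hic] by simp
  show mu: "\<mu> \<in> carrier_vec a" unfolding \<mu>_def by (rule mult_mat_vec_carrier[OF W(1) z])
  have Gm: "GA\<^sup>T *\<^sub>v \<mu> \<in> carrier_vec m" by (rule mult_mat_vec_carrier[OF GT mu])
  have HiG: "minv H *\<^sub>v (GA\<^sup>T *\<^sub>v \<mu>) \<in> carrier_vec m" by (rule mult_mat_vec_carrier[OF Hi(1) Gm])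
  show U: "U \<in> carrier_vec m" unfolding U_def using Hic HiG by simp
  have HHi: "H *\<^sub>v (minv H *\<^sub>v v) = v" if "v \<in> carrier_vec m" for v
    using assoc_mult_mat_vec[OF Hc Hi(1) that] Hi(2) that by simp
  show "H *\<^sub>v U + c = GA\<^sup>T *\<^sub>v \<mu>"
    unfolding U_def mult_minus_distrib_mat_vec[OF Hc HiG Hic] HHi[OF Gm] HHi[OF c]
    using Gm c by (intro eq_vecI) (simp_all del: index_mult_mat_vec dim_mult_mat_vec add: carrier_vecD)
  have K: "GA * minv H * GA\<^sup>T \<in> carrier_mat a a"
    by (rule mult_carrier_mat[OF mult_carrier_mat[OF GA Hi(1)] GT])
  have "GA *\<^sub>v (minv H *\<^sub>v (GA\<^sup>T *\<^sub>v \<mu>)) = (GA * minv H * GA\<^sup>T) *\<^sub>v \<mu>"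
    using assoc_mult_mat_vec[OF mult_carrier_mat[OF GA Hi(1)] GT mu] assoc_mult_mat_vec[OF GA Hi(1) Gm]
    by simp
  also have "\<dots> = ?z"
    unfolding \<mu>_def using assoc_mult_mat_vec[OF K W(1) z] W(2) z by simp
  finally show "GA *\<^sub>v U = b"
    unfolding U_def mult_minus_distrib_mat_vec[OF GA HiG Hic]
    using b GA by (intro eq_vecI) (auto simp del: index_mult_mat_vec)
qed

text \<open>With \<open>d = V - U\<close>, the exact expansion of the cost at \<open>U\<close> has the linear term
  \<open>(H U + c) \<bullet> d = \<mu> \<bullet> G d\<close>, a sum of products of two nonpositive numbers.  The quadratic
  term that remains gives optimality and uniqueness at once.\<close>

lemma quadratic_growth_of_KKT:
  assumes H: "pd m H" and c: "c \<in> carrier_vec m" and G: "G \<in> carrier_mat a m"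
    and U: "U \<in> carrier_vec m" and V: "V \<in> carrier_vec m" and \<mu>: "\<mu> \<in> carrier_vec a"
    and stationary: "H *\<^sub>v U + c = G\<^sup>T *\<^sub>v \<mu>" and sign: "\<And>i. i < a \<Longrightarrow> \<mu> $ i \<le> 0"
    and V_le: "G *\<^sub>v V \<le> G *\<^sub>v U"
  shows "1/2 * (U \<bullet> (H *\<^sub>v U)) + c \<bullet> U + 1/2 * ((V - U) \<bullet> (H *\<^sub>v (V - U))) \<le> 1/2 * (V \<bullet> (H *\<^sub>v V)) + c \<bullet> V"
proof -
  have Hc: "H \<in> carrier_mat m m" "H\<^sup>T = H" using H by (auto simp: pd_def)
  define d where "d = V - U"
  have d: "d \<in> carrier_vec m" using U V by (simp add: d_def)
  have Vd: "V = U + d" and dV: "V - U = d" unfolding d_def using U V by (intro eq_vecI) auto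
  have HU: "H *\<^sub>v U \<in> carrier_vec m" by (rule mult_mat_vec_carrier[OF Hc(1) U])
  have Gd: "G *\<^sub>v d \<in> carrier_vec a" by (rule mult_mat_vec_carrier[OF G d])
  have Gdi: "(G *\<^sub>v d) $ i \<le> 0" if "i < a" for i
    using V_le that G
    unfolding Vd mult_add_distrib_mat_vec[OF G U d]
    by (auto simp: less_eq_vec_def simp del: index_mult_mat_vec)
  have "U \<bullet> (H *\<^sub>v d) + c \<bullet> d = (H *\<^sub>v U + c) \<bullet> d"
    unfolding add_scalar_prod_distrib[OF HU c d]
    using transpose_vec_mult_scalar[OF Hc(1) d U] Hc(2) by simp
  also have "\<dots> = \<mu> \<bullet> (G *\<^sub>v d)"
    unfolding stationary using transpose_vec_mult_scalar[OF G d \<mu>] by simp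
  also have "\<dots> \<ge> 0"
    unfolding scalar_prod_def using \<mu> Gd G sign Gdi
    by (intro sum_nonneg mult_nonpos_nonpos) (auto simp del: index_mult_mat_vec)
  finally have "0 \<le> U \<bullet> (H *\<^sub>v d) + c \<bullet> d" .
  then show ?thesis
    unfolding dV unfolding Vd quad_expand[OF Hc U d] scalar_prod_add_distrib[OF c U d]
    by (simp add: field_simps)
qed

section \<open>The Hessian of the condensed program\<close>

lemma transpose_msum: "(msum r c f N)\<^sup>T = msum c r (\<lambda>k. (f k)\<^sup>T) N"
  if f: "\<And>k. k < N \<Longrightarrow> f k \<in> carrier_mat r c"
proof (rule eq_matI)
  fix i j assume ij: "i < dim_row (msum c r (\<lambda>k. (f k)\<^sup>T) N)" "j < dim_col (msum c r (\<lambda>k. (f k)\<^sup>T) N)"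
  have "f k $$ (j, i) = (f k)\<^sup>T $$ (i, j)" if "k < N" for k
    using that[THEN f] ij by (simp add: msum_def)
  then show "(msum r c f N)\<^sup>T $$ (i, j) = msum c r (\<lambda>k. (f k)\<^sup>T) N $$ (i, j)"
    using ij by (simp add: msum_def)
qed (simp_all add: msum_def)

lemma transpose_sandwich:
  assumes "X \<in> carrier_mat n a" "M \<in> carrier_mat n n" "M\<^sup>T = (M :: real mat)"
  shows "(X\<^sup>T * M * X)\<^sup>T = X\<^sup>T * M * X"
  using assms transpose_mult[of "X\<^sup>T * M" a n X a] transpose_mult[of "X\<^sup>T" a n M n]
    assoc_mult_mat[of "X\<^sup>T" a n M n X a] by simp

text \<open>Positivity is read off from the optimal control problem with initial state \<open>0\<close>, whose cost is
  \<open>1/2 U \<bullet> H U\<close>: all its terms are nonnegative, and a nonzero \<open>U\<close> has a nonzero input at some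
  time, which costs something.\<close>

lemma Hmat_pd:
  assumes D: "standing_assumptions D"
  shows "pd (nU D) (Hmat D)"
proof -
  let ?N = "hor D" and ?P = "Pmat D" and ?Q = "Qmat D" and ?R = "Rmat D" and ?m = "nU D"
  have P: "?P \<in> carrier_mat (nx D) (nx D)" "?P\<^sup>T = ?P"
    and P0: "\<And>v. v \<in> carrier_vec (nx D) \<Longrightarrow> v \<bullet> (?P *\<^sub>v v) \<ge> 0"
    and Q: "?Q \<in> carrier_mat (nx D) (nx D)" "?Q\<^sup>T = ?Q"
    and Q0: "\<And>v. v \<in> carrier_vec (nx D) \<Longrightarrow> v \<bullet> (?Q *\<^sub>v v) \<ge> 0"
    and R: "?R \<in> carrier_mat (nu D) (nu D)" "?R\<^sup>T = ?R" and Rpd: "pd (nu D) ?R"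
    and A: "Amat D \<in> carrier_mat (nx D) (nx D)" and B: "Bmat D \<in> carrier_mat (nx D) (nu D)"
    using D by (auto simp: standing_assumptions_def psd_def pd_def)
  have sandC: "\<And>X M n a. X \<in> carrier_mat n a \<Longrightarrow> M \<in> carrier_mat n n \<Longrightarrow>
      X\<^sup>T * M * (X :: real mat) \<in> carrier_mat a a" by (meson mult_carrier_mat transpose_carrier_mat)
  have c: "(Gam D k)\<^sup>T * ?Q * Gam D k + (sel D k)\<^sup>T * ?R * sel D k \<in> carrier_mat ?m ?m" for k
    by (intro add_carrier_mat sandC[OF sel_carrier R(1)])
  have t: "((Gam D k)\<^sup>T * ?Q * Gam D k + (sel D k)\<^sup>T * ?R * sel D k)\<^sup>T
      = (Gam D k)\<^sup>T * ?Q * Gam D k + (sel D k)\<^sup>T * ?R * sel D k" for k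
    by (simp only: transpose_add[OF sandC[OF Gam_carrier Q(1)] sandC[OF sel_carrier R(1)]]
        transpose_sandwich[OF Gam_carrier Q] transpose_sandwich[OF sel_carrier R])
  have smT: "(2 \<cdot>\<^sub>m M)\<^sup>T = 2 \<cdot>\<^sub>m M\<^sup>T" for M :: "real mat" by (intro eq_matI) auto
  have Hc: "Hmat D \<in> carrier_mat ?m ?m"
    unfolding Hmat_def by (intro smult_carrier_mat add_carrier_mat msum_carrier)
  have Ht: "(Hmat D)\<^sup>T = Hmat D"
    unfolding Hmat_def smT
    by (simp only: transpose_add[OF sandC[OF Gam_carrier P(1)] msum_carrier]
        transpose_msum[OF c] t transpose_sandwich[OF Gam_carrier P])
  have "U \<bullet> (Hmat D *\<^sub>v U) > 0" if U: "U \<in> carrier_vec ?m" and U0: "U \<noteq> 0\<^sub>v ?m" for U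
  proof -
    let ?x = "0\<^sub>v (nx D) :: real vec"
    have F: "Fmat D \<in> carrier_mat (nx D) ?m"
      unfolding Fmat_def by (intro smult_carrier_mat add_carrier_mat msum_carrier)
    have Y: "Ymat D \<in> carrier_mat (nx D) (nx D)"
      unfolding Ymat_def by (intro smult_carrier_mat add_carrier_mat msum_carrier)
    have "1/2 * (U \<bullet> (Hmat D *\<^sub>v U)) = qp_cost D ?x U"
      using mult_mat_vec_carrier[OF F U] mult_mat_vec_carrier[OF Y zero_carrier_vec]
      by (simp add: qp_cost_def)
    also have "\<dots> = ocp_cost D ?x U" by (rule qp_cost_eq[OF D zero_carrier_vec U])
    also have "\<dots> > 0"
    proof -
      have st: "state D ?x U k \<in> carrier_vec (nx D)" if "k \<le> hor D" for k
        unfolding state_eq[OF A B zero_carrier_vec U that]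
        by (intro add_carrier_vec mult_mat_vec_carrier[OF Gam_carrier U]
            mult_mat_vec_carrier[of _ "nx D" "nx D"]) (use A in \<open>auto simp: Phi_def\<close>)
      obtain i where i: "i < ?m" "U $ i \<noteq> 0" 
        using eq_vecI[of U "0\<^sub>v ?m"] carrier_vecD[OF U] U0 by force
      \<comment> \<open>Entry \<open>i\<close> of the stacked vector is entry \<open>i mod nu D\<close> of the input at time \<open>i div nu D\<close>.\<close>
      define k where "k = i div nu D"
      have nu: "nu D > 0" using i by (cases "nu D") (auto simp: nU_def)
      have k: "k < ?N" unfolding k_def using i nu
        by (simp add: nU_def less_mult_imp_div_less mult.commute)
      have "input D U k $ (i mod nu D) \<noteq> 0"
        using i nu by (simp add: input_def k_def)
      then have "input D U k \<noteq> 0\<^sub>v (nu D)" using nu by (auto simp del: index_zero_vec simp: index_zero_vec(1))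
      then have pos: "input D U k \<bullet> (?R *\<^sub>v input D U k) > 0"
        using Rpd by (auto simp: pd_def)
      have R0: "v \<bullet> (?R *\<^sub>v v) \<ge> 0" if "v \<in> carrier_vec (nu D)" for v
        using pd_kernel[OF Rpd that] R that by fastforce
      have "0 < (\<Sum>k<?N. state D ?x U k \<bullet> (?Q *\<^sub>v state D ?x U k) + input D U k \<bullet> (?R *\<^sub>v input D U k))"
        using k pos by (intro sum_pos2[of _ k] add_nonneg_nonneg add_nonneg_pos Q0 R0 st) auto
      then show ?thesis unfolding ocp_cost_def using P0[OF st, of ?N] by simp
    qed
    finally show ?thesis by simp
  qed
  then show ?thesis using Hc Ht by (simp add: pd_def)
qed

section \<open>The first stage of the constraints\<close>

lemma constraint_dims:
  assumes "standing_assumptions D"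
  shows "HX D \<in> carrier_mat (dim_vec (hX D)) (nx D)" "HU D \<in> carrier_mat (dim_vec (hU D)) (nu D)"
    "HT D \<in> carrier_mat (dim_vec (hT D)) (nx D)"
    "Amat D \<in> carrier_mat (nx D) (nx D)" "Bmat D \<in> carrier_mat (nx D) (nu D)" "hor D \<ge> 2"
  using assms unfolding standing_assumptions_def polytope_around_0_def by blast+

lemma qp_carriers:
  assumes D: "standing_assumptions D"
  shows "Gmat D \<in> carrier_mat (dim_row (Gmat D)) (nU D)"
    "wvec D \<in> carrier_vec (dim_row (Gmat D))"
    "Emat D \<in> carrier_mat (dim_row (Gmat D)) (nx D)"
    "Fmat D \<in> carrier_mat (nx D) (nU D)"
proof -
  let ?g = "\<lambda>k. rows (HU D * sel D k) @ rows (HS D (Suc k) * Gam D (Suc k))"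
  let ?w = "\<lambda>k. list_of_vec (hU D) @ list_of_vec (hS D (Suc k))"
  let ?e = "\<lambda>k. rows (0\<^sub>m (dim_row (HU D)) (nx D)) @ rows (- (HS D (Suc k) * Phi D (Suc k)))"
  have d: "dim_row (HX D) = dim_vec (hX D)" "dim_row (HU D) = dim_vec (hU D)"
    "dim_row (HT D) = dim_vec (hT D)"
    using constraint_dims(1-3)[OF D] by simp_all
  have len: "\<And>k. length (?g k) = length (?w k) \<and> length (?e k) = length (?w k)"
    using d by (simp add: HS_def hS_def)
  note cc = ineqs_concat(1,2)[of "[0..<hor D]" ?g ?w ?e, OF len]
  show "Gmat D \<in> carrier_mat (dim_row (Gmat D)) (nU D)" 
    by (intro carrier_matI) (simp_all add: Gmat_def)
  show "wvec D \<in> carrier_vec (dim_row (Gmat D))"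
    unfolding wvec_def Gmat_def using cc(1) d by (intro carrier_vecI) simp
  show "Emat D \<in> carrier_mat (dim_row (Gmat D)) (nx D)"
    unfolding Emat_def Gmat_def using cc d by (intro carrier_matI) simp_all
  show "Fmat D \<in> carrier_mat (nx D) (nU D)"
    unfolding Fmat_def by (intro smult_carrier_mat add_carrier_mat msum_carrier)
qed

text \<open>The first stage consists of the rows of \<open>HU * sel 0\<close> and \<open>HX * Gam 1\<close>.  Both \<open>sel 0\<close> and
  \<open>Gam 1 = B * sel 0\<close> vanish on the columns of the later inputs.\<close>

lemma Gmat_stage_rows:
  assumes D: "standing_assumptions D"
  shows "qstage D \<le> dim_row (Gmat D)" "nu D \<le> nU D"
    "\<And>i j. i < qstage D \<Longrightarrow> nu D \<le> j \<Longrightarrow> j < nU D \<Longrightarrow> Gmat D $$ (i, j) = 0"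
proof -
  let ?g = "\<lambda>k. rows (HU D * sel D k) @ rows (HS D (Suc k) * Gam D (Suc k))"
  have N: "hor D \<ge> 2" and HX: "dim_col (HX D) = nx D" and HU: "dim_col (HU D) = nu D"
    and B: "Bmat D \<in> carrier_mat (nx D) (nu D)" and A: "Amat D \<in> carrier_mat (nx D) (nx D)"
    using constraint_dims[OF D] by simp_all
  show "nu D \<le> nU D" using N by (simp add: nU_def)
  have HS: "HS D (Suc 0) = HX D" using N by (simp add: HS_def)
  define rest where "rest = concat (map ?g [Suc 0..<hor D]) @ rows (0\<^sub>m (dim_row (HX D)) (nU D))"
  have G: "Gmat D = mat_of_rows (nU D) (rows (HU D * sel D 0) @ rows (HX D * Gam D 1) @ rest)"
    unfolding Gmat_def rest_def using N by (simp add: upt_conv_Cons HS)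
  show "qstage D \<le> dim_row (Gmat D)" by (simp add: G qstage_def)
  fix i j assume i: "i < qstage D" and j: "nu D \<le> j" "j < nU D"
  have s: "col (sel D 0) j = 0\<^sub>v (nu D)"
    using j by (intro eq_vecI) (auto simp: sel_def)
  have g: "col (Gam D 1) j = 0\<^sub>v (nx D)"
  proof -
    have "(Amat D ^\<^sub>m 0 * Bmat D * sel D 0) $$ (r, j) = 0" if "r < nx D" for r
      using that j s A B carrier_matD[OF sel_carrier[of D 0]]
      by (subst index_mult_mat) (auto intro: scalar_prod_right_zero)
    then show ?thesis using j by (intro eq_vecI) (auto simp: Gam_def msum_def)
  qed
  show "Gmat D $$ (i, j) = 0"
  proof (cases "i < dim_row (HU D)")
    case True
    then have "Gmat D $$ (i, j) = (HU D * sel D 0) $$ (i, j)"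
      using i j carrier_matD[OF sel_carrier[of D 0]] by (simp add: G mat_of_rows_def nth_append)
    also have "\<dots> = row (HU D) i \<bullet> 0\<^sub>v (nu D)"
      using True j s carrier_matD[OF sel_carrier[of D 0]] by simp
    also have "\<dots> = 0" using HU by (intro scalar_prod_right_zero) (auto intro: carrier_vecI)
    finally show ?thesis .
  next
    case False
    then have i': "i - dim_row (HU D) < dim_row (HX D)" using i by (auto simp: qstage_def)
    then have "Gmat D $$ (i, j) = (HX D * Gam D 1) $$ (i - dim_row (HU D), j)"
      using i j False carrier_matD[OF Gam_carrier[of D 1]]
      by (simp add: G mat_of_rows_def nth_append qstage_def)
    also have "\<dots> = row (HX D) (i - dim_row (HU D)) \<bullet> 0\<^sub>v (nx D)"
      using i' j g carrier_matD[OF Gam_carrier[of D 1]] by simp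
    also have "\<dots> = 0" using HX by (intro scalar_prod_right_zero) (auto intro: carrier_vecI)
    finally show ?thesis .
  qed
qed

lemma pick_lessThan: "i < n \<Longrightarrow> pick {..<n} i = i"
  using pick_reduce_set[of i n UNIV] by (simp add: pick_UNIV lessThan_def)

lemma G11_mult_vec_first:
  assumes D: "standing_assumptions D" and U: "U \<in> carrier_vec (nU D)"
  shows "G11 D \<in> carrier_mat (qstage D) (nu D)"
    "\<And>i. i < qstage D \<Longrightarrow> (G11 D *\<^sub>v vec_first U (nu D)) $ i = (Gmat D *\<^sub>v U) $ i"
proof -
  note S = Gmat_stage_rows[OF D]
  have G: "dim_col (Gmat D) = nU D" using qp_carriers(1)[OF D] by simp
  have "{i. i < dim_row (Gmat D) \<and> i \<in> {..<qstage D}} = {..<qstage D}"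
    "{i. i < nU D \<and> i \<in> {..<nu D}} = {..<nu D}" using S(1,2) by auto
  then have G11: "G11 D = mat (qstage D) (nu D) (\<lambda>(i, j). Gmat D $$ (i, j))"
    unfolding G11_def submatrix_def G by (intro eq_matI) (auto simp: pick_lessThan)
  then show "G11 D \<in> carrier_mat (qstage D) (nu D)" by simp
  fix i assume i: "i < qstage D"
  have "(Gmat D *\<^sub>v U) $ i = (\<Sum>j<nU D. Gmat D $$ (i, j) * U $ j)"
    using i S(1) U G by (simp add: scalar_prod_def atLeast0LessThan)
  also have "\<dots> = (\<Sum>j<nu D. Gmat D $$ (i, j) * U $ j)"
    using S(2) S(3)[OF i] by (intro sum.mono_neutral_right) auto
  also have "\<dots> = (G11 D *\<^sub>v vec_first U (nu D)) $ i"
    using i by (simp add: G11 scalar_prod_def atLeast0LessThan vec_first_def)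
  finally show "(G11 D *\<^sub>v vec_first U (nu D)) $ i = (Gmat D *\<^sub>v U) $ i" by simp
qed

section \<open>The regions and the feedback law\<close>

text \<open>Since \<open>S = E + G H\<^sup>-\<^sup>1 F\<^sup>T\<close>, the vector \<open>w\<^sub>A + S\<^sub>A x\<close> is \<open>b\<^sub>A + G\<^sub>A h\<close>, where \<open>b\<close> is the right-hand
  side of the constraints and \<open>- h\<close> the unconstrained minimiser.  The first block of \<open>T x \<le> d\<close>
  becomes \<open>\<mu> \<le> 0\<close>.  With \<open>K = G\<^sub>I H\<^sup>-\<^sup>1 G\<^sub>A\<^sup>T W\<close>, the second one is \<open>K (w\<^sub>A + S\<^sub>A x) \<le> w\<^sub>I + S\<^sub>I x\<close>;
  its sides are \<open>G\<^sub>I U + G\<^sub>I h\<close> and \<open>b\<^sub>I + G\<^sub>I h\<close>, so it is feasibility outside \<open>\<A>\<close>.\<close>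

lemma Pi_region_inequalities:
  assumes D: "standing_assumptions D" and x: "x \<in> Pi_region D \<A>"
    and full: "full_row_rank (rows_of (Gmat D) \<A>)"
  defines "G\<^sub>A \<equiv> rows_of (Gmat D) \<A>" and "G\<^sub>I \<equiv> rows_of (Gmat D) (Qset D - \<A>)"
    and "a \<equiv> card {i. i < dim_row (Gmat D) \<and> i \<in> \<A>}"
    and "b \<equiv> wvec D + Emat D *\<^sub>v x" and "h \<equiv> minv (Hmat D) *\<^sub>v ((Fmat D)\<^sup>T *\<^sub>v x)"
  defines "\<mu> \<equiv> Wmat D \<A> *\<^sub>v (entries_of b \<A> + G\<^sub>A *\<^sub>v h)"
  defines "U \<equiv> minv (Hmat D) *\<^sub>v (G\<^sub>A\<^sup>T *\<^sub>v \<mu>) - h"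
  shows "\<And>i. i < a \<Longrightarrow> \<mu> $ i \<le> 0" "G\<^sub>I *\<^sub>v U \<le> entries_of b (Qset D - \<A>)"
proof -
  let ?q = "dim_row (Gmat D)" and ?m = "nU D" and ?W = "Wmat D \<A>" and ?I = "Qset D - \<A>"
    and ?Hi = "minv (Hmat D)" and ?S = "Smat D"
  let ?wA = "entries_of (wvec D) \<A>" and ?wI = "entries_of (wvec D) ?I"
  define p where "p = card {i. i < ?q \<and> i \<in> ?I}"
  note car = qp_carriers[OF D]
  have H: "pd ?m (Hmat D)" by (rule Hmat_pd[OF D])
  note Hi = pd_minv(1)[OF H]
  have xc: "x \<in> carrier_vec (nx D)" and le: "PiT D \<A> *\<^sub>v x \<le> Pid D \<A>"
    using x by (auto simp: Pi_region_def)
  have GA: "G\<^sub>A \<in> carrier_mat a ?m" unfolding G\<^sub>A_def a_def by (rule rows_of_carrier[OF car(1)])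
  have GI: "G\<^sub>I \<in> carrier_mat p ?m" unfolding G\<^sub>I_def p_def by (rule rows_of_carrier[OF car(1)])
  have GAT: "G\<^sub>A\<^sup>T \<in> carrier_mat ?m a" using GA by simp
  have W: "?W \<in> carrier_mat a a"
    using gram_minv(1)[OF H GA] full by (simp add: Wmat_def G\<^sub>A_def)
  have FT: "(Fmat D)\<^sup>T \<in> carrier_mat ?m (nx D)" using car(4) by simp
  have c: "(Fmat D)\<^sup>T *\<^sub>v x \<in> carrier_vec ?m" by (rule mult_mat_vec_carrier[OF FT xc])
  have h: "h \<in> carrier_vec ?m" unfolding h_def by (rule mult_mat_vec_carrier[OF Hi c])
  have Ex: "Emat D *\<^sub>v x \<in> carrier_vec ?q" by (rule mult_mat_vec_carrier[OF car(3) xc])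
  have Gh: "Gmat D *\<^sub>v h \<in> carrier_vec ?q" by (rule mult_mat_vec_carrier[OF car(1) h])
  have GHi: "Gmat D * ?Hi \<in> carrier_mat ?q ?m" by (rule mult_carrier_mat[OF car(1) Hi])
  have GHF: "Gmat D * ?Hi * (Fmat D)\<^sup>T \<in> carrier_mat ?q (nx D)" by (rule mult_carrier_mat[OF GHi FT])
  have S: "?S \<in> carrier_mat ?q (nx D)" unfolding Smat_def using GHF by (rule add_carrier_mat)
  have Sx: "?S *\<^sub>v x = Emat D *\<^sub>v x + Gmat D *\<^sub>v h"
    unfolding Smat_def add_mult_distrib_mat_vec[OF car(3) GHF xc] assoc_mult_mat_vec[OF GHi FT xc]
      assoc_mult_mat_vec[OF car(1) Hi c] h_def ..
  have SJ: "rows_of ?S J *\<^sub>v x = entries_of (Emat D *\<^sub>v x) J + rows_of (Gmat D) J *\<^sub>v h" for J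
    unfolding rows_of_mult_vec[OF S xc] rows_of_mult_vec[OF car(1) h] Sx
    by (rule entries_of_add) (use car(3) in simp)
  have bJ: "entries_of b J = entries_of (wvec D) J + entries_of (Emat D *\<^sub>v x) J" for J
    unfolding b_def by (rule entries_of_add) (use car(2,3) in simp)
  have SA: "rows_of ?S \<A> \<in> carrier_mat a (nx D)" unfolding a_def by (rule rows_of_carrier[OF S])
  have SI: "rows_of ?S ?I \<in> carrier_mat p (nx D)" unfolding p_def by (rule rows_of_carrier[OF S])
  have SAx: "rows_of ?S \<A> *\<^sub>v x \<in> carrier_vec a" by (rule mult_mat_vec_carrier[OF SA xc])
  have wA: "?wA \<in> carrier_vec a" unfolding a_def by (rule entries_of_carrier) (use car(2) in simp)
  have wI: "?wI \<in> carrier_vec p" unfolding p_def by (rule entries_of_carrier) (use car(2) in simp)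
  have ExA: "entries_of (Emat D *\<^sub>v x) \<A> \<in> carrier_vec a"
    unfolding a_def by (rule entries_of_carrier) (use car(3) in simp)
  have ExI: "entries_of (Emat D *\<^sub>v x) ?I \<in> carrier_vec p"
    unfolding p_def by (rule entries_of_carrier) (use car(3) in simp)
  have GAh: "G\<^sub>A *\<^sub>v h \<in> carrier_vec a" by (rule mult_mat_vec_carrier[OF GA h])
  have GIh: "G\<^sub>I *\<^sub>v h \<in> carrier_vec p" by (rule mult_mat_vec_carrier[OF GI h])
  define z where "z = ?wA + rows_of ?S \<A> *\<^sub>v x"
  have z: "z \<in> carrier_vec a" unfolding z_def using wA SAx by simp
  have mu: "\<mu> = ?W *\<^sub>v z"
    unfolding \<mu>_def z_def SJ bJ G\<^sub>A_def using assoc_add_vec[OF wA ExA GAh[unfolded G\<^sub>A_def]] by simp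
  have muc: "\<mu> \<in> carrier_vec a" unfolding mu by (rule mult_mat_vec_carrier[OF W z])
  define K where "K = G\<^sub>I * ?Hi * G\<^sub>A\<^sup>T * ?W"
  have GIHi: "G\<^sub>I * ?Hi \<in> carrier_mat p ?m" by (rule mult_carrier_mat[OF GI Hi])
  have K1: "G\<^sub>I * ?Hi * G\<^sub>A\<^sup>T \<in> carrier_mat p a" by (rule mult_carrier_mat[OF GIHi GAT])
  have K: "K \<in> carrier_mat p a" unfolding K_def by (rule mult_carrier_mat[OF K1 W])
  have Gm: "G\<^sub>A\<^sup>T *\<^sub>v \<mu> \<in> carrier_vec ?m" by (rule mult_mat_vec_carrier[OF GAT muc])
  have HiG: "?Hi *\<^sub>v (G\<^sub>A\<^sup>T *\<^sub>v \<mu>) \<in> carrier_vec ?m" by (rule mult_mat_vec_carrier[OF Hi Gm])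
  have Kz: "G\<^sub>I *\<^sub>v (?Hi *\<^sub>v (G\<^sub>A\<^sup>T *\<^sub>v \<mu>)) = K *\<^sub>v z"
    unfolding K_def assoc_mult_mat_vec[OF K1 W z] mu[symmetric] assoc_mult_mat_vec[OF GIHi GAT muc]
      assoc_mult_mat_vec[OF GI Hi Gm] ..
  have WwA: "?W *\<^sub>v ?wA \<in> carrier_vec a" by (rule mult_mat_vec_carrier[OF W wA])
  have KwA: "K *\<^sub>v ?wA \<in> carrier_vec p" by (rule mult_mat_vec_carrier[OF K wA])
  have WS: "?W *\<^sub>v (rows_of ?S \<A> *\<^sub>v x) \<in> carrier_vec a" by (rule mult_mat_vec_carrier[OF W SAx])
  have KS: "K *\<^sub>v (rows_of ?S \<A> *\<^sub>v x) \<in> carrier_vec p" by (rule mult_mat_vec_carrier[OF K SAx])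
  have WSA: "?W * rows_of ?S \<A> \<in> carrier_mat a (nx D)" by (rule mult_carrier_mat[OF W SA])
  have KSA: "K * rows_of ?S \<A> \<in> carrier_mat p (nx D)" by (rule mult_carrier_mat[OF K SA])
  have T: "PiT D \<A> = (?W * rows_of ?S \<A>) @\<^sub>r (K * rows_of ?S \<A> - rows_of ?S ?I)"
    unfolding PiT_def Let_def K_def G\<^sub>A_def G\<^sub>I_def ..
  have d: "Pid D \<A> = - (?W *\<^sub>v ?wA) @\<^sub>v - (K *\<^sub>v ?wA - ?wI)"
    unfolding Pid_def Let_def K_def G\<^sub>A_def G\<^sub>I_def by (intro eq_vecI) auto
  have T2: "K * rows_of ?S \<A> - rows_of ?S ?I \<in> carrier_mat p (nx D)"
    using KSA SI by (intro minus_carrier_mat)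
  have d1: "- (?W *\<^sub>v ?wA) \<in> carrier_vec a" using WwA by (rule uminus_carrier_vec[THEN iffD2])
  have "(?W * rows_of ?S \<A>) *\<^sub>v x \<le> - (?W *\<^sub>v ?wA)"
    and "(K * rows_of ?S \<A> - rows_of ?S ?I) *\<^sub>v x \<le> - (K *\<^sub>v ?wA - ?wI)"
    using le unfolding T d append_rows_le[OF WSA T2 d1 xc] by blast+
  then have le1: "?W *\<^sub>v (rows_of ?S \<A> *\<^sub>v x) \<le> - (?W *\<^sub>v ?wA)"
    and le2: "K *\<^sub>v (rows_of ?S \<A> *\<^sub>v x) - rows_of ?S ?I *\<^sub>v x \<le> - (K *\<^sub>v ?wA - ?wI)"
    unfolding minus_mult_distrib_mat_vec[OF KSA SI xc] assoc_mult_mat_vec[OF W SA xc]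
      assoc_mult_mat_vec[OF K SA xc] by blast+
  show "\<mu> $ i \<le> 0" if "i < a" for i
  proof -
    have "(?W *\<^sub>v (rows_of ?S \<A> *\<^sub>v x)) $ i \<le> - (?W *\<^sub>v ?wA) $ i"
      using le1 that WwA by (auto simp: less_eq_vec_def simp del: index_mult_mat_vec dim_mult_mat_vec)
    then show ?thesis
      unfolding mu z_def mult_add_distrib_mat_vec[OF W wA SAx]
      using that WwA WS by (simp del: index_mult_mat_vec dim_mult_mat_vec)
  qed
  have U: "G\<^sub>I *\<^sub>v U = K *\<^sub>v ?wA + K *\<^sub>v (rows_of ?S \<A> *\<^sub>v x) - G\<^sub>I *\<^sub>v h"
    unfolding U_def mult_minus_distrib_mat_vec[OF GI HiG h] Kz z_def
      mult_add_distrib_mat_vec[OF K wA SAx] ..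
  have SI': "rows_of ?S ?I *\<^sub>v x = entries_of (Emat D *\<^sub>v x) ?I + G\<^sub>I *\<^sub>v h"
    unfolding SJ G\<^sub>I_def ..
  show "G\<^sub>I *\<^sub>v U \<le> entries_of b ?I"
    using le2 KwA KS GIh ExI wI unfolding U bJ SI'
    by (auto simp: less_eq_vec_def simp del: index_mult_mat_vec dim_mult_mat_vec)
qed

text \<open>The Karush-Kuhn-Tucker point of the equality-constrained problem is the solution.  A competitor
  \<open>V\<close> enters only through \<open>G\<^sub>A V \<le> b\<^sub>A = G\<^sub>A U\<close>, which is what \<open>quadratic_growth_of_KKT\<close> asks for.\<close>

lemma Pi_region_solution:
  assumes D: "standing_assumptions D" and x: "x \<in> Pi_region D \<A>"
    and full: "full_row_rank (rows_of (Gmat D) \<A>)" and sub: "\<A> \<subseteq> Qset D"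
  obtains U where "qp_solution D x U" "\<And>V. qp_solution D x V \<Longrightarrow> V = U"
    "\<And>i. i \<in> \<A> \<Longrightarrow> (Gmat D *\<^sub>v U) $ i = (wvec D + Emat D *\<^sub>v x) $ i"
proof -
  let ?q = "dim_row (Gmat D)" and ?m = "nU D"
  define GA where "GA = rows_of (Gmat D) \<A>"
  define GI where "GI = rows_of (Gmat D) (Qset D - \<A>)"
  define a where "a = card {i. i < ?q \<and> i \<in> \<A>}"
  define b where "b = wvec D + Emat D *\<^sub>v x"
  define c where "c = (Fmat D)\<^sup>T *\<^sub>v x"
  define h where "h = minv (Hmat D) *\<^sub>v c"
  define \<mu> where "\<mu> = Wmat D \<A> *\<^sub>v (entries_of b \<A> + GA *\<^sub>v h)"
  define U where "U = minv (Hmat D) *\<^sub>v (GA\<^sup>T *\<^sub>v \<mu>) - h"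
  note car = qp_carriers[OF D]
  note defs = GA_def GI_def a_def b_def c_def h_def \<mu>_def U_def
  have H: "pd ?m (Hmat D)" by (rule Hmat_pd[OF D])
  have xc: "x \<in> carrier_vec (nx D)" using x by (auto simp: Pi_region_def)
  have GA: "GA \<in> carrier_mat a ?m" unfolding GA_def a_def by (rule rows_of_carrier[OF car(1)])
  have fullA: "full_row_rank GA" using full by (simp add: GA_def)
  have FT: "(Fmat D)\<^sup>T \<in> carrier_mat ?m (nx D)" using car(4) by simp
  have c: "c \<in> carrier_vec ?m" unfolding c_def by (rule mult_mat_vec_carrier[OF FT xc])
  have b: "b \<in> carrier_vec ?q"
    unfolding b_def using car(2) mult_mat_vec_carrier[OF car(3) xc] by (rule add_carrier_vec)
  then have bA: "entries_of b \<A> \<in> carrier_vec a" unfolding a_def by (intro entries_of_carrier) simp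
  have W: "Wmat D \<A> = minv (GA * minv (Hmat D) * GA\<^sup>T)" by (simp add: Wmat_def GA_def)
  note kkt = multiplier_stationary[OF H GA fullA bA c, folded W h_def, folded \<mu>_def, folded U_def]
  have sign: "\<And>i. i < a \<Longrightarrow> \<mu> $ i \<le> 0"
    and inact: "GI *\<^sub>v U \<le> entries_of b (Qset D - \<A>)"
    using Pi_region_inequalities[OF D x full] unfolding defs by blast+
  have GU: "dim_vec (Gmat D *\<^sub>v V) = ?q" for V by simp
  have bq: "dim_vec b = ?q" using b by simp
  have act: "(Gmat D *\<^sub>v U) $ i = b $ i" if "i \<in> \<A>" for i
  proof -
    have "i < ?q" using that sub by (auto simp: Qset_def)
    moreover have "entries_of (Gmat D *\<^sub>v U) \<A> = entries_of b \<A>"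
      using kkt(4) rows_of_mult_vec[OF car(1) kkt(2)] by (simp add: GA_def)
    ultimately show ?thesis using that entries_of_eq_iff[OF GU bq] by blast
  qed
  have "(Gmat D *\<^sub>v U) $ i \<le> b $ i" if "i < ?q" for i
  proof (cases "i \<in> \<A>")
    case False
    have "entries_of (Gmat D *\<^sub>v U) (Qset D - \<A>) \<le> entries_of b (Qset D - \<A>)"
      using inact rows_of_mult_vec[OF car(1) kkt(2)] by (simp add: GI_def)
    then show ?thesis using False that entries_of_le_iff[OF GU bq] by (auto simp: Qset_def)
  qed (simp add: act)
  then have feas: "qp_feasible D x U"
    using kkt(2) bq by (simp add: qp_feasible_def less_eq_vec_def flip: b_def)
  have cost: "qp_cost D x V = 1/2 * (V \<bullet> (Hmat D *\<^sub>v V)) + c \<bullet> V + 1/2 * (x \<bullet> (Ymat D *\<^sub>v x))"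
    if "V \<in> carrier_vec ?m" for V
    using transpose_vec_mult_scalar[OF car(4) that xc] by (simp add: qp_cost_def c_def)
  have growth: "qp_cost D x U + 1/2 * ((V - U) \<bullet> (Hmat D *\<^sub>v (V - U))) \<le> qp_cost D x V"
    if V: "qp_feasible D x V" for V
  proof -
    have Vc: "V \<in> carrier_vec ?m" and "Gmat D *\<^sub>v V \<le> b"
      using V by (auto simp: qp_feasible_def b_def)
    then have "entries_of (Gmat D *\<^sub>v V) \<A> \<le> entries_of b \<A>"
      using entries_of_le_iff[OF GU bq] bq by (simp add: less_eq_vec_def)
    then have "GA *\<^sub>v V \<le> GA *\<^sub>v U"
      using kkt(4) rows_of_mult_vec[OF car(1) Vc] by (simp add: GA_def)
    from quadratic_growth_of_KKT[OF H c GA kkt(2) Vc kkt(1,3) sign this]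
    show ?thesis using cost[OF Vc] cost[OF kkt(2)] by simp
  qed
  have nonneg: "0 \<le> d \<bullet> (Hmat D *\<^sub>v d)" if "d \<in> carrier_vec ?m" for d
  proof (rule ccontr)
    assume "\<not> ?thesis"
    then show False using pd_kernel[OF H that] that
      mult_mat_vec_carrier[of "Hmat D" ?m ?m d] H by (auto simp: pd_def)
  qed
  show thesis
  proof
    show "qp_solution D x U"
      unfolding qp_solution_def
    proof (intro conjI allI impI feas)
      fix V assume V: "qp_feasible D x V"
      then have "V - U \<in> carrier_vec ?m" using kkt(2) by (auto simp: qp_feasible_def)
      then show "qp_cost D x U \<le> qp_cost D x V" using growth[OF V] nonneg by fastforce
    qed
    show "V = U" if V: "qp_solution D x V" for V
    proof -
      have fV: "qp_feasible D x V" and "qp_cost D x V \<le> qp_cost D x U"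
        using V feas by (auto simp: qp_solution_def)
      then have "(V - U) \<bullet> (Hmat D *\<^sub>v (V - U)) \<le> 0" using growth[OF fV] by simp
      moreover have Vc: "V \<in> carrier_vec ?m" using fV by (simp add: qp_feasible_def)
      ultimately have "V - U = 0\<^sub>v ?m" using pd_kernel[OF H] kkt(2) by simp
      have "V $ i = U $ i" if i: "i < ?m" for i
        using arg_cong[OF \<open>V - U = 0\<^sub>v ?m\<close>, of "\<lambda>v. v $ i"] i Vc kkt(2) by simp
      then show ?thesis using Vc kkt(2) by (intro eq_vecI) auto
    qed
    show "(Gmat D *\<^sub>v U) $ i = (wvec D + Emat D *\<^sub>v x) $ i" if "i \<in> \<A>" for i
      using act[OF that] by (simp add: b_def)
  qed
qed

text \<open>On the selected first-stage rows, \<open>G U = w + E x\<close> reads \<open>G\<^sup>1\<^sup>1 u 0 = w + E x\<close>.  Since the selected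
  block of \<open>G\<^sup>1\<^sup>1\<close> is square, these are as many equations as \<open>u 0\<close> has components.\<close>

lemma first_input_of_active_stage:
  assumes D: "standing_assumptions D" and inv: "invertible_mat (rows_of (G11 D) (\<A> \<inter> {..<qstage D}))"
    and x: "x \<in> carrier_vec (nx D)" and U: "U \<in> carrier_vec (nU D)"
    and act: "\<And>i. i \<in> \<A> \<inter> {..<qstage D} \<Longrightarrow> (Gmat D *\<^sub>v U) $ i = (wvec D + Emat D *\<^sub>v x) $ i"
  shows "vec_first U (nu D) = Kstar D \<A> *\<^sub>v x + bstar D \<A>"
proof -
  define J where "J = \<A> \<inter> {..<qstage D}"
  let ?u = "vec_first U (nu D)" and ?M = "rows_of (G11 D) J"
    and ?w = "entries_of (wvec D) J" and ?E = "rows_of (Emat D) J"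
  note car = qp_carriers[OF D]
  have u: "?u \<in> carrier_vec (nu D)" by simp
  have qs: "qstage D \<le> dim_row (Gmat D)" by (rule Gmat_stage_rows(1)[OF D])
  have Jq: "{i. i < qstage D \<and> i \<in> J} = J" "{i. i < dim_row (Gmat D) \<and> i \<in> J} = J"
    using qs by (auto simp: J_def)
  note G11 = G11_mult_vec_first(1)[OF D U]
  have sq: "dim_row ?M = dim_col ?M" using inv by (simp add: invertible_mat_def J_def)
  have M0: "?M \<in> carrier_mat (card J) (nu D)"
    using rows_of_carrier[OF G11, of J] Jq by simp
  then have cJ: "card J = nu D" using sq by simp
  then have M: "?M \<in> carrier_mat (nu D) (nu D)" using M0 by simp
  have E: "?E \<in> carrier_mat (nu D) (nx D)"
    using rows_of_carrier[OF car(3), of J] Jq cJ by simp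
  have w: "?w \<in> carrier_vec (nu D)"
    using entries_of_carrier[of "wvec D" "dim_row (Gmat D)" J] car(2) Jq cJ by simp
  have Ex: "?E *\<^sub>v x \<in> carrier_vec (nu D)" by (rule mult_mat_vec_carrier[OF E x])
  have Mi: "minv ?M \<in> carrier_mat (nu D) (nu D)" "minv ?M * ?M = 1\<^sub>m (nu D)"
    using minv_inverse[OF M invertible_mat_kernel[OF _ M]] inv by (auto simp: J_def)
  have "?M *\<^sub>v ?u = ?E *\<^sub>v x + ?w"
  proof (rule eq_vecI)
    fix k assume "k < dim_vec (?E *\<^sub>v x + ?w)"
    then have k: "k < card J" using w cJ by simp
    have p: "pick J k \<in> J" using pick_in_set[of k J] k by simp
    have "(?M *\<^sub>v ?u) $ k = (G11 D *\<^sub>v ?u) $ pick J k"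
      unfolding rows_of_mult_vec[OF G11 u]
      using k Jq carrier_matD(1)[OF G11] by (subst entries_of_index) simp_all
    also have "\<dots> = (Gmat D *\<^sub>v U) $ pick J k"
      using p by (intro G11_mult_vec_first(2)[OF D U]) (simp add: J_def)
    also have "\<dots> = (wvec D + Emat D *\<^sub>v x) $ pick J k" using act p by (simp add: J_def)
    also have "\<dots> = (entries_of (wvec D + Emat D *\<^sub>v x) J) $ k"
      using k Jq car(2,3) by (subst entries_of_index) simp_all
    also have "entries_of (wvec D + Emat D *\<^sub>v x) J = ?E *\<^sub>v x + ?w"
      unfolding rows_of_mult_vec[OF car(3) x]
      using entries_of_add[of "wvec D" "Emat D *\<^sub>v x" J] car(2,3) w Ex[unfolded rows_of_mult_vec[OF car(3) x]]
      by (simp add: comm_add_vec)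
    finally show "(?M *\<^sub>v ?u) $ k = (?E *\<^sub>v x + ?w) $ k" .
  qed (use M w in simp)
  then have "minv ?M *\<^sub>v (?M *\<^sub>v ?u) = minv ?M *\<^sub>v (?E *\<^sub>v x) + minv ?M *\<^sub>v ?w"
    using mult_add_distrib_mat_vec[OF Mi(1) Ex w] by simp
  moreover have "minv ?M *\<^sub>v (?M *\<^sub>v ?u) = ?u"
    using assoc_mult_mat_vec[OF Mi(1) M u] Mi(2) u by simp
  ultimately show ?thesis
    unfolding Kstar_def bstar_def Let_def J_def[symmetric] assoc_mult_mat_vec[OF Mi(1) E x] by simp
qed

theorem proposition1:
  fixes D :: ocp and \<A> :: "nat set"
  assumes "standing_assumptions D"
    and "\<A> \<subseteq> Qset D"
    and "\<exists>x\<in>Xf D. active_set D x = \<A>"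
    and "invertible_mat (rows_of (G11 D) (\<A> \<inter> {..<qstage D}))"
  shows "\<forall>x\<in>Gamma_region D \<A>.
    qp_solution D x (Uopt D x) \<and>
    vec_first (Uopt D x) (nu D) = Kstar D \<A> *\<^sub>v x + bstar D \<A>"
proof
  fix x assume "x \<in> Gamma_region D \<A>"
  then obtain \<A>' where \<A>': "\<A>' \<subseteq> Qset D" "\<A>' \<inter> {..<qstage D} = \<A> \<inter> {..<qstage D}"
    "full_row_rank (rows_of (Gmat D) \<A>')" and x: "x \<in> Pi_region D \<A>'"
    by (auto simp: Gamma_region_def Mset_def)
  obtain U where U: "qp_solution D x U" "\<And>V. qp_solution D x V \<Longrightarrow> V = U"
    and act: "\<And>i. i \<in> \<A>' \<Longrightarrow> (Gmat D *\<^sub>v U) $ i = (wvec D + Emat D *\<^sub>v x) $ i"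
    using Pi_region_solution[OF assms(1) x \<A>'(3,1)] by blast
  have "Uopt D x = U" unfolding Uopt_def using U by (rule the_equality)
  moreover have "vec_first U (nu D) = Kstar D \<A> *\<^sub>v x + bstar D \<A>"
  proof (rule first_input_of_active_stage[OF assms(1,4)])
    show "x \<in> carrier_vec (nx D)" using x by (simp add: Pi_region_def)
    show "U \<in> carrier_vec (nU D)" using U(1) by (simp add: qp_solution_def qp_feasible_def)
    show "(Gmat D *\<^sub>v U) $ i = (wvec D + Emat D *\<^sub>v x) $ i" if "i \<in> \<A> \<inter> {..<qstage D}" for i
      using act that \<A>'(2) by blast
  qed
  ultimately show "qp_solution D x (Uopt D x) \<and>
      vec_first (Uopt D x) (nu D) = Kstar D \<A> *\<^sub>v x + bstar D \<A>"
    using U(1) by simp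
qed

end
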